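(* Let $q$ be a prime and $\mathbb{F}$ a field. Suppose that $\mathrm{GL}(q,\mathbb{F})$ has irreducible abelian subgroups, and let $H$ be an irreducible maximal abelian subgroup of $\mathrm{GL}(q,\mathbb{F})$. (i) If $\mathbb{F}^\times$ has no element of order $q$, then $H$ is a maximal locally nilpotent subgroup of $\mathrm{GL}(q,\mathbb{F})$, and any irreducible maximal locally nilpotent subgroup of $\mathrm{GL}(q,\mathbb{F})$ is abelian. (ii) Suppose that $\mathbb{F}^\times$ has an element of order $q$. Then $H$ is a maximal locally nilpotent subgroup of $\mathrm{GL}(q,\mathbb{F})$ unless $q=2$ and $\mathbb{F}$ contains no square root of $-1$; in that case, $H$ is a maximal locally nilpotent subgroup of $\mathrm{GL}(2,\mathbb{F})$ if and only if $H/\mathbb{F}^\times1_2$ is not a $2$-group.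
   Context: A group is locally nilpotent if every finite subset generates a nilpotent subgroup. A maximal locally nilpotent (respectively maximal abelian) subgroup of $\mathrm{GL}(q,\mathbb{F})$ is one not properly contained in another locally nilpotent (respectively abelian) subgroup of $\mathrm{GL}(q,\mathbb{F})$. Irreducible means irreducible over $\mathbb{F}$ in its action on $\mathbb{F}^q$. $1_2$ is the $2\times2$ identity matrix. A $2$-group is a (possibly infinite) group in which every element has order a power of $2$. *)

theory Defs
  imports
    "HOL-Computational_Algebra.Primes"
    "HOL-Analysis.Determinants"
    "HOL-Algebra.Generated_Groups"
    "HOL-Algebra.Multiplicative_Group"
begin

(* The group parameter is a plain monoid record; subgroups M of G are turned into groups by
   G\<lparr>carrier := M\<rparr>, as in HOL-Algebra. *)

primrec lower_central_series :: "'g monoid \<Rightarrow> nat \<Rightarrow> 'g set" where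
  "lower_central_series G 0 = carrier G"
| "lower_central_series G (Suc n) =
     generate G {x \<otimes>\<^bsub>G\<^esub> y \<otimes>\<^bsub>G\<^esub> inv\<^bsub>G\<^esub> x \<otimes>\<^bsub>G\<^esub> inv\<^bsub>G\<^esub> y | x y.
       x \<in> lower_central_series G n \<and> y \<in> carrier G}"

definition nilpotent_group :: "'g monoid \<Rightarrow> bool" where
  "nilpotent_group G \<longleftrightarrow> group G \<and> (\<exists>n. lower_central_series G n = {\<one>\<^bsub>G\<^esub>})"

definition locally_nilpotent :: "'g monoid \<Rightarrow> bool" where
  "locally_nilpotent G \<longleftrightarrow> group G \<and>
     (\<forall>S. finite S \<and> S \<subseteq> carrier G \<longrightarrow> nilpotent_group (G\<lparr>carrier := generate G S\<rparr>))"

definition p_group :: "nat \<Rightarrow> 'g monoid \<Rightarrow> bool" where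
  "p_group p G \<longleftrightarrow> group G \<and> (\<forall>x\<in>carrier G. \<exists>k. group.ord G x = p ^ k)"

definition maximal_subgroup_with :: "('g monoid \<Rightarrow> bool) \<Rightarrow> 'g monoid \<Rightarrow> 'g set \<Rightarrow> bool" where
  "maximal_subgroup_with P G M \<longleftrightarrow> subgroup M G \<and> P (G\<lparr>carrier := M\<rparr>) \<and>
     \<not> (\<exists>N. subgroup N G \<and> P (G\<lparr>carrier := N\<rparr>) \<and> M \<subset> N)"

abbreviation maximal_abelian_subgroup :: "'g monoid \<Rightarrow> 'g set \<Rightarrow> bool" where
  "maximal_abelian_subgroup \<equiv> maximal_subgroup_with comm_group"

abbreviation maximal_locally_nilpotent_subgroup :: "'g monoid \<Rightarrow> 'g set \<Rightarrow> bool" where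
  "maximal_locally_nilpotent_subgroup \<equiv> maximal_subgroup_with locally_nilpotent"

definition GL :: "('a::field ^ 'n ^ 'n) monoid" where
  "GL = \<lparr>carrier = {A. invertible A}, mult = (**), one = mat 1\<rparr>"

(* Nonzero elements of a field under multiplication (HOL-Algebra's mult_of expects a ring record). *)
definition field_units :: "'a::field monoid" where
  "field_units = \<lparr>carrier = {x. x \<noteq> 0}, mult = (*), one = 1\<rparr>"

definition scalar_matrices :: "('a::field ^ 'n ^ 'n) set" where
  "scalar_matrices = mat ` carrier field_units"

(* The ambient space 'a ^ 'n is never zero, since the index type is nonempty. *)
definition irreducible_matrices :: "('a::field ^ 'n ^ 'n) set \<Rightarrow> bool" where
  "irreducible_matrices H \<longleftrightarrow>
     (\<forall>W. vec.subspace W \<and> (\<forall>A\<in>H. \<forall>w\<in>W. A *v w \<in> W) \<longrightarrow> W = {0} \<or> W = UNIV)"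

lemma group_GL: "group (GL :: ('a::field ^ 'n ^ 'n) monoid)"
proof (rule groupI)
  fix A :: "'a ^ 'n ^ 'n" assume "A \<in> carrier GL"
  then show "\<exists>B\<in>carrier GL. B \<otimes>\<^bsub>GL\<^esub> A = \<one>\<^bsub>GL\<^esub>"
    unfolding GL_def invertible_def by auto
qed (auto simp: GL_def invertible_mult matrix_mul_assoc invertible_def[of "mat 1"])

lemma comm_group_field_units: "comm_group (field_units :: 'a::field monoid)"
  by (rule comm_groupI) (auto simp: field_units_def mult_ac intro: exI[of _ "inverse _"] bexI[of _ "inverse _"])

end

theory Submission
  imports Defs
begin

text \<open>
  Write \<open>F\<close> for the base field and \<open>q = CARD('n)\<close>. By Schur's lemma and maximality, \<open>H\<close> together with
  zero is a field \<open>\<Delta>\<close>, of degree \<open>q\<close> over the scalars. As \<open>q\<close> is prime, every nonscalar element of \<open>H\<close>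
  generates \<open>\<Delta>\<close>, and its centralizer is \<open>\<Delta>\<close> itself (\<open>centralizer_commutative\<close>,
  \<open>centralizer_of_nonscalar\<close>).

  A nilpotent, irreducible and nonabelian group \<open>N\<close> has only scalars in its center, for otherwise it
  would lie in a commutative centralizer. So a noncentral element \<open>a\<close> of its second center satisfies
  \<open>a y = \<lambda> y a\<close> for some \<open>y \<in> N\<close> and a scalar \<open>\<lambda> \<noteq> 1\<close>, and determinants give \<open>\<lambda> ^ q = 1\<close>. A locally nilpotent irreducible
  nonabelian group contains such an \<open>N\<close>, because finitely many of its elements span all of them
  linearly. Hence if \<open>F\<close> has no element of order \<open>q\<close>, every irreducible locally nilpotent
  group is abelian (\<open>locally_nilpotent_root_of_unity\<close>).

  Now let \<open>L\<close> be a locally nilpotent group properly containing \<open>H\<close>. The element \<open>a\<close> can be found in \<open>H\<close>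
  (\<open>locally_nilpotent_above_twisted\<close>), and then some \<open>g \<in> L\<close> acts on \<open>\<Delta>\<close> by conjugation as a generator \<open>\<sigma>\<close>
  of the Galois group, with \<open>\<sigma> a = \<lambda> a\<close>. For each \<open>b \<in> H\<close> the group generated by \<open>b\<close> and \<open>g\<close> is nilpotent, so iterating
  \<open>x \<mapsto> x / \<sigma> x\<close> from \<open>b\<close> ends at the identity. Starting from \<open>1 + a\<close>, the last nonscalar term is an
  eigenvector of \<open>\<sigma>\<close> of norm one (\<open>norm_one_eigenvector\<close>). If \<open>q\<close> is odd its \<open>q\<close>-th power is \<open>1\<close>, and if \<open>q = 2\<close> its
  square is \<open>-1\<close>; since \<open>F\<close> already contains all \<open>q\<close>-th roots of unity, this is only possible
  if \<open>q = 2\<close> and \<open>-1\<close> is not a square in \<open>F\<close>. In that case \<open>x / \<sigma> x\<close> is \<open>x ^ 2\<close> modulo scalars, so every element of \<open>H\<close>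
  has a scalar power with exponent a power of two (\<open>two_power_scalar\<close>).

  Conversely, let \<open>q = 2\<close>, let the characteristic be different from \<open>2\<close>, and let \<open>H\<close> modulo scalars be a
  \<open>2\<close>-group. A matrix \<open>g\<close> inducing the Galois automorphism exists (\<open>degree_2_twist\<close>), and
  \<open>H \<union> H g\<close> is a locally nilpotent group larger than \<open>H\<close>, because commutation with \<open>g\<close> squares modulo
  scalars (\<open>adjoin_locally_nilpotent\<close>).
\<close>

section \<open>Scalar matrices and Schur's lemma\<close>

lemma mat_comm: "mat c ** A = A ** mat c" for A :: "'a::field^'n^'n"
  by (simp add: matrix_matrix_mult_def mat_def vec_eq_iff if_distrib if_distribR mult.commute cong: if_cong)

lemma mat_vec: "mat c *v v = c *s v" for v :: "'a::field^'n"
  by (simp add: matrix_vector_mult_def mat_def vec_eq_iff if_distrib if_distribR cong: if_cong)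

lemma mat_mult: "mat c ** mat d = (mat (c * d) :: 'a::field^'n^'n)"
  by (simp add: matrix_eq matrix_vector_mul_assoc[symmetric] mat_vec)

lemma mat_inj: "mat c = (mat d :: 'a::field^'n^'n) \<longleftrightarrow> c = d"
  by (auto simp: mat_def vec_eq_iff split: if_splits)

lemma mat_add: "mat c + mat d = (mat (c + d) :: 'a::field^'n^'n)"
  by (simp add: mat_def vec_eq_iff)

lemma mat_diff: "mat c - mat d = (mat (c - d) :: 'a::field^'n^'n)"
  by (simp add: mat_def vec_eq_iff)

lemma matrix_add_right_distrib: "(B + C) ** A = B ** A + C ** A" for A :: "'a::field^'n^'n"
  by (simp add: matrix_matrix_mult_def vec_eq_iff distrib_right sum.distrib)

lemma matrix_diff_ldistrib: "A ** (B - C) = A ** B - A ** C" for A :: "'a::field^'n^'n"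
  by (simp add: matrix_matrix_mult_def vec_eq_iff algebra_simps sum_subtractf)

lemma matrix_diff_rdistrib: "(B - C) ** A = B ** A - C ** A" for A :: "'a::field^'n^'n"
  by (simp add: matrix_matrix_mult_def vec_eq_iff algebra_simps sum_subtractf)

text \<open>
  Schur's lemma: the kernel of a matrix commuting with every element of \<open>N\<close> is an \<open>N\<close>-invariant
  subspace.
\<close>

lemma schur:
  fixes Z :: "'a::field^'n^'n"
  assumes "irreducible_matrices N" and "\<And>A. A \<in> N \<Longrightarrow> A ** Z = Z ** A" and "Z \<noteq> 0"
  shows "invertible Z"
proof -
  let ?W = "{w. Z *v w = 0}"
  have "vec.subspace ?W"
    by (auto simp: vec.subspace_def matrix_vector_right_distrib vec.scale)
  moreover have "A *v w \<in> ?W" if "A \<in> N" "w \<in> ?W" for A w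
  proof -
    have "Z *v (A *v w) = A *v (Z *v w)"
      using assms(2)[OF that(1)] by (simp add: matrix_vector_mul_assoc)
    then show ?thesis using that(2) by simp
  qed
  ultimately have "?W = {0} \<or> ?W = UNIV"
    using assms(1) unfolding irreducible_matrices_def by blast
  moreover have "?W \<noteq> UNIV"
  proof
    assume "?W = UNIV"
    then have "\<forall>w. Z *v w = 0" by blast
    then have "Z = 0"
      by (simp only: matrix_eq matrix_vector_mult_0 simp_thms)
    then show False using assms(3) by blast
  qed
  ultimately have "\<forall>w. Z *v w = 0 \<longrightarrow> w = 0" by blast
  then show ?thesis
    by (simp only: invertible_left_inverse matrix_left_invertible_ker)
qed

text \<open>
  Schur's lemma for \<open>Z - mat c\<close>, which is singular.
\<close>

lemma eigenvalue_scalar: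
  fixes Z :: "'a::field^'n^'n"
  assumes "irreducible_matrices N" and "\<And>A. A \<in> N \<Longrightarrow> A ** Z = Z ** A"
    and "Z *v v = c *s v" and "v \<noteq> 0"
  shows "Z = mat c"
proof (rule ccontr)
  assume "Z \<noteq> mat c"
  have "invertible (Z - mat c)"
  proof (rule schur[OF assms(1)])
    show "A ** (Z - mat c) = (Z - mat c) ** A" if "A \<in> N" for A
      using assms(2)[OF that] by (simp only: matrix_diff_ldistrib matrix_diff_rdistrib mat_comm[of c A])
    show "Z - mat c \<noteq> 0" using \<open>Z \<noteq> mat c\<close> by simp
  qed
  moreover have "(Z - mat c) *v v = 0"
    using assms(3) by (simp add: matrix_vector_mult_diff_rdistrib mat_vec)
  ultimately show False
    using assms(4) unfolding invertible_left_inverse matrix_left_invertible_ker by blast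
qed

section \<open>Centralizers over a prime degree\<close>

text \<open>
  The bicommutant \<open>K\<close> of \<open>Z\<close> is commutative and centralizes \<open>N\<close>, so by Schur's lemma it is a field, and
  \<open>'a^'n\<close> is a vector space over it. Hence the dimension \<open>d\<close> of a line \<open>K v\<close> over the base field
  divides the prime \<open>CARD('n)\<close>. A value \<open>d = 1\<close> would make \<open>v\<close> an eigenvector of \<open>Z\<close>, and \<open>Z\<close> a scalar;
  so \<open>K v\<close> is the whole space, and a matrix commuting with \<open>Z\<close>, hence with \<open>K\<close>, is determined by its
  value at \<open>v\<close> and therefore lies in \<open>K\<close>.

  Instead of a \<open>K\<close>-basis, the proof that \<open>d\<close> divides the dimension uses the irreducibility of \<open>N\<close>: the
  lines \<open>K (A v) = A (K v)\<close> with \<open>A \<in> N\<close> all have dimension \<open>d\<close>, and together they span the space.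
\<close>

lemma centralizer_commutative:
  fixes Z :: "'a::field^'n^'n"
  assumes irr: "irreducible_matrices N"
    and mult: "\<And>A B. A \<in> N \<Longrightarrow> B \<in> N \<Longrightarrow> A ** B \<in> N" and one: "mat 1 \<in> N"
    and inv: "\<And>A. A \<in> N \<Longrightarrow> invertible A"
    and comm: "\<And>A. A \<in> N \<Longrightarrow> A ** Z = Z ** A"
    and prime: "prime CARD('n)" and nonscalar: "Z \<notin> range mat"
    and X: "X ** Z = Z ** X" and Y: "Y ** Z = Z ** Y"
  shows "X ** Y = Y ** X"
proof -
  define K where "K = {k. \<forall>x. x ** Z = Z ** x \<longrightarrow> x ** k = k ** x}"
  have K: "x ** k = k ** x" if "k \<in> K" "x ** Z = Z ** x" for k x
    using that unfolding K_def by blast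
  have ZK: "Z \<in> K" and matK: "mat c \<in> K" for c
    unfolding K_def by (auto simp: mat_comm)
  have addK: "k + l \<in> K" if "k \<in> K" "l \<in> K" for k l
    using that unfolding K_def by (simp add: matrix_add_ldistrib matrix_add_right_distrib)
  have multK: "k ** l \<in> K" if "k \<in> K" "l \<in> K" for k l
  proof -
    have "x ** (k ** l) = k ** l ** x" if x: "x ** Z = Z ** x" for x
    proof -
      have "x ** (k ** l) = (x ** k) ** l" by (rule matrix_mul_assoc)
      also have "\<dots> = k ** (x ** l)" unfolding K[OF \<open>k \<in> K\<close> x] by (rule matrix_mul_assoc[symmetric])
      also have "\<dots> = k ** l ** x" unfolding K[OF \<open>l \<in> K\<close> x] by (rule matrix_mul_assoc)
      finally show ?thesis .
    qed
    then show ?thesis unfolding K_def by blast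
  qed
  have KZ: "k ** Z = Z ** k" if "k \<in> K" for k
    using K[OF that] by simp
  have KK: "k ** l = l ** k" if "k \<in> K" "l \<in> K" for k l
    using K[OF that(2) KZ[OF that(1)]] .
  have KN: "A ** k = k ** A" if "k \<in> K" "A \<in> N" for k A
    using K[OF that(1) comm[OF that(2)]] .
  have invK: "\<exists>l\<in>K. l ** k = mat 1" if "k \<in> K" "k \<noteq> 0" for k
  proof -
    have "invertible k"
      using schur[OF irr KN[OF that(1)] that(2)] .
    then obtain l where l: "k ** l = mat 1" "l ** k = mat 1"
      unfolding invertible_def by blast
    have "x ** l = l ** x" if "x ** Z = Z ** x" for x
    proof -
      have "x ** l = (l ** k) ** x ** l" by (simp add: l)
      also have "\<dots> = l ** (k ** x) ** l" by (simp add: matrix_mul_assoc)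
      also have "\<dots> = l ** (x ** k) ** l" using K[OF \<open>k \<in> K\<close> that] by simp
      also have "\<dots> = l ** x ** (k ** l)" by (simp add: matrix_mul_assoc)
      finally show ?thesis by (simp add: l)
    qed
    then show ?thesis using l(2) unfolding K_def by blast
  qed
  \<comment> \<open>the line spanned by \<open>w\<close> over the field \<open>K\<close>\<close>
  define orb where "orb w = (\<lambda>k. k *v w) ` K" for w
  have orb_sub: "vec.subspace (orb w)" for w
  proof (rule vec.subspaceI)
    show "0 \<in> orb w"
      unfolding orb_def using matK[of 0] by (intro image_eqI[of _ _ "mat 0"]) (auto simp only: mat_0 matrix_vector_mult_0)
    show "x + y \<in> orb w" if "x \<in> orb w" "y \<in> orb w" for x y
      using that addK unfolding orb_def by (auto simp flip: matrix_vector_mult_add_rdistrib)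
    show "c *s x \<in> orb w" if "x \<in> orb w" for c x
      using that multK[OF matK] unfolding orb_def by (auto simp: matrix_vector_mul_assoc simp flip: mat_vec)
  qed
  have orb_inv: "k *v x \<in> orb w" if "k \<in> K" "x \<in> orb w" for k x w
    using that multK unfolding orb_def by (auto simp: matrix_vector_mul_assoc)
  have orb_self: "w \<in> orb w" for w
    unfolding orb_def using matK[of 1] by (intro image_eqI[of _ _ "mat 1"]) auto
  obtain v :: "'a^'n" where v: "v \<noteq> 0"
    using exI[of "\<lambda>v. v \<noteq> 0" "vec 1 :: 'a^'n"] by (auto simp: vec_eq_iff)
  define d where "d = vec.dim (orb v)"
  have "d \<noteq> 0"
    using orb_self[of v] v unfolding d_def by auto
  \<comment> \<open>the \<open>K\<close>-subspaces of dimension divisible by \<open>d\<close>; a largest one is the whole space\<close>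
  define good where "good U \<longleftrightarrow> vec.subspace U \<and> (\<forall>k\<in>K. \<forall>u\<in>U. k *v u \<in> U) \<and> d dvd vec.dim U"
    for U :: "('a^'n) set"
  have enlarge: "\<exists>U'. good U' \<and> vec.dim U < vec.dim U'" if U: "good U" "U \<noteq> UNIV" for U
  proof -
    have subU: "vec.subspace U" and invU: "\<And>k u. k \<in> K \<Longrightarrow> u \<in> U \<Longrightarrow> k *v u \<in> U"
      using U(1) unfolding good_def by auto
    obtain A where A: "A \<in> N" "A *v v \<notin> U"
    proof -
      \<comment> \<open>the vectors whose \<open>N\<close>-orbit lies in \<open>U\<close> form an \<open>N\<close>-invariant subspace\<close>
      let ?W = "{w. \<forall>A\<in>N. A *v w \<in> U}"
      have "vec.subspace ?W"
        using subU unfolding vec.subspace_def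
        by (auto simp: matrix_vector_right_distrib vec.scale)
      moreover have "\<forall>B\<in>N. \<forall>w\<in>?W. B *v w \<in> ?W"
        using mult by (auto simp: matrix_vector_mul_assoc)
      ultimately have "?W = {0} \<or> ?W = UNIV"
        using irr unfolding irreducible_matrices_def by blast
      moreover have "?W \<noteq> UNIV"
      proof
        assume "?W = UNIV"
        then have "mat 1 *v w \<in> U" for w using one by blast
        then show False using U(2) by auto
      qed
      ultimately have "v \<notin> ?W" using v by blast
      then show ?thesis using that by blast
    qed
    let ?T = "orb (A *v v)"
    have "?T = (*v) A ` orb v"
      unfolding orb_def image_image using KN[OF _ A(1)] by (auto simp: matrix_vector_mul_assoc)
    moreover have "inj ((*v) A)"
      using inv[OF A(1)] by (metis inj_matrix_vector_mult)
    ultimately have dimT: "vec.dim ?T = d"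
      unfolding d_def by (metis vec.dim_image_eq matrix_vector_mul_linear_gen inj_on_subset subset_UNIV)
    have "U \<inter> ?T = {0}"
    proof -
      have "x = 0" if "x \<in> U" "x \<in> ?T" for x
      proof (rule ccontr)
        assume "x \<noteq> 0"
        obtain k where k: "k \<in> K" "x = k *v (A *v v)" using \<open>x \<in> ?T\<close> unfolding orb_def by blast
        with \<open>x \<noteq> 0\<close> have "k \<noteq> 0" by auto
        with invK k(1) obtain l where l: "l \<in> K" "l ** k = mat 1" by blast
        have "l *v x = (l ** k) *v (A *v v)" unfolding k(2) by (rule matrix_vector_mul_assoc)
        then have "l *v x = A *v v" unfolding l(2) by simp
        with invU[OF l(1) \<open>x \<in> U\<close>] A(2) show False by simp
      qed
      then show ?thesis using vec.subspace_0[OF subU] vec.subspace_0[OF orb_sub] by blast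
    qed
    define U' where "U' = {x + y |x y. x \<in> U \<and> y \<in> ?T}"
    have "vec.dim U' + vec.dim (U \<inter> ?T) = vec.dim U + vec.dim ?T"
      unfolding U'_def by (rule vec.dim_sums_Int[OF subU orb_sub])
    then have dim: "vec.dim U' = vec.dim U + d"
      unfolding \<open>U \<inter> ?T = {0}\<close> dimT by simp
    have "vec.subspace U'"
      unfolding U'_def by (rule vec.subspace_sums[OF subU orb_sub])
    moreover have "k *v u \<in> U'" if ku: "k \<in> K" "u \<in> U'" for k u
    proof -
      obtain x y where xy: "u = x + y" "x \<in> U" "y \<in> ?T" using ku(2) unfolding U'_def by blast
      then have "k *v u = k *v x + k *v y" by (simp add: matrix_vector_right_distrib)
      then show ?thesis
        unfolding U'_def using invU[OF ku(1) xy(2)] orb_inv[OF ku(1) xy(3)] by blast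
    qed
    moreover have "d dvd vec.dim U'"
      using U(1) unfolding dim good_def by simp
    ultimately have "good U'" unfolding good_def by blast
    then show ?thesis using dim \<open>d \<noteq> 0\<close> by (intro exI[of _ U']) simp
  qed
  have "d dvd CARD('n)"
  proof -
    have "good {0}" unfolding good_def by simp
    moreover have "\<forall>U. good U \<longrightarrow> vec.dim U < Suc (CARD('n))"
      by (metis less_Suc_eq_le vec.dim_subset_UNIV vec.dimension_def vec_dim_card vec.dim_UNIV)
    ultimately obtain U where U: "good U" "\<forall>U'. good U' \<longrightarrow> vec.dim U' \<le> vec.dim U"
      using ex_has_greatest_nat[of good "{0}" vec.dim "Suc CARD('n)"] by blast
    then have "U = UNIV" using enlarge[OF U(1)] by (metis not_le)
    then show ?thesis using U(1) unfolding good_def by (simp only: vec_dim_card)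
  qed
  then have "d = 1 \<or> d = CARD('n)"
    using prime by (simp add: prime_nat_iff)
  moreover have "d \<noteq> 1"
  proof
    assume "d = 1"
    have "vec.span {v} = orb v"
    proof (rule vec.subspace_dim_equal[OF vec.subspace_span orb_sub])
      show "vec.span {v} \<subseteq> orb v"
        using orb_self orb_sub by (intro vec.span_minimal) auto
      have "vec.dim (vec.span {v}) = 1"
        using v vec.dim_eq_card_independent[of "{v}"] by (simp only: vec.dim_span) simp
      then show "vec.dim (orb v) \<le> vec.dim (vec.span {v})"
        using \<open>d = 1\<close> unfolding d_def by simp
    qed
    moreover have "Z *v v \<in> orb v" using ZK unfolding orb_def by blast
    ultimately obtain c where "Z *v v = c *s v"
      unfolding vec.span_singleton by blast
    then have "Z = mat c" using eigenvalue_scalar[OF irr comm] v by blast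
    then show False using nonscalar by blast
  qed
  ultimately have "orb v = UNIV"
    by (intro vec.subspace_dim_equal[OF orb_sub vec.subspace_UNIV]) (auto simp only: d_def vec_dim_card subset_UNIV)
  then obtain k where k: "k \<in> K" "X *v v = k *v v"
    unfolding orb_def by (metis UNIV_I imageE)
  \<comment> \<open>\<open>X\<close> and \<open>k\<close> agree at \<open>v\<close> and both commute with \<open>K\<close>, which moves \<open>v\<close> everywhere\<close>
  have "X *v w = k *v w" for w
  proof -
    obtain l where l: "l \<in> K" "w = l *v v"
      using \<open>orb v = UNIV\<close> unfolding orb_def by (metis UNIV_I imageE)
    have "X *v w = (X ** l) *v v" unfolding l(2) by (rule matrix_vector_mul_assoc)
    also have "\<dots> = l *v (X *v v)" unfolding K[OF l(1) X] by (rule matrix_vector_mul_assoc[symmetric])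
    also have "\<dots> = (l ** k) *v v" unfolding k(2) by (rule matrix_vector_mul_assoc)
    also have "\<dots> = k *v w" unfolding KK[OF l(1) k(1)] l(2) by (rule matrix_vector_mul_assoc[symmetric])
    finally show ?thesis .
  qed
  then have "X = k" by (simp only: matrix_eq simp_thms)
  then show ?thesis using K[OF k(1) Y] by simp
qed

text \<open>
  A subspace invariant under \<open>S\<close> is invariant under the linear span of \<open>S\<close>, so \<open>S\<close> may be any basis of the
  span of \<open>N\<close> chosen inside \<open>N\<close>. To have linear algebra over \<open>'a\<close> for matrices, they are read as
  vectors with index type \<open>'n \<times> 'n\<close>.
\<close>

lemma finite_irreducible_subset:
  fixes N :: "('a::field^'n^'n) set"
  assumes "irreducible_matrices N"
  obtains S where "finite S" "S \<subseteq> N" "irreducible_matrices S"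
proof -
  define flat where "flat A = (\<chi> p. A $ fst p $ snd p)" for A :: "'a^'n^'n"
  define act where "act m w = (\<chi> i. \<Sum>j\<in>UNIV. m $ (i, j) * w $ j)" for m :: "'a^('n \<times> 'n)" and w
  have app: "act (flat A) w = A *v w" for A w
    by (simp add: flat_def act_def matrix_vector_mult_def)
  have "inj flat"
    by (rule injI) (simp add: flat_def vec_eq_iff)
  obtain B where B: "B \<subseteq> flat ` N" "vec.independent B" "flat ` N \<subseteq> vec.span B"
    by (rule vec.basis_exists[of "flat ` N"])
  define S where "S = {A \<in> N. flat A \<in> B}"
  have "flat ` S \<subseteq> B" unfolding S_def by blast
  then have "finite S"
    using finite_imageD[OF finite_subset[OF _ vec.finiteI_independent[OF B(2)]]
        inj_on_subset[OF \<open>inj flat\<close> subset_UNIV]] by blast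
  moreover have "S \<subseteq> N" unfolding S_def by blast
  moreover have "irreducible_matrices S"
    unfolding irreducible_matrices_def
  proof (intro allI impI)
    fix W :: "('a^'n) set"
    assume W: "vec.subspace W \<and> (\<forall>A\<in>S. \<forall>w\<in>W. A *v w \<in> W)"
    have "A *v w \<in> W" if "A \<in> N" "w \<in> W" for A w
    proof -
      have "vec.subspace {m. act m w \<in> W}"
      proof (rule vec.subspaceI; clarsimp)
        have "act 0 w = 0" by (simp add: act_def vec_eq_iff)
        then show "act 0 w \<in> W" using W by (simp add: vec.subspace_0)
        show "act (x + y) w \<in> W" if "act x w \<in> W" "act y w \<in> W" for x y
        proof -
          have "act (x + y) w = act x w + act y w"
            by (simp add: act_def vec_eq_iff distrib_right sum.distrib)
          then show ?thesis using W that by (simp add: vec.subspace_add)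
        qed
        show "act (c *s x) w \<in> W" if "act x w \<in> W" for c x
        proof -
          have "act (c *s x) w = c *s act x w"
            by (simp add: act_def vec_eq_iff sum_distrib_left mult.assoc)
          then show ?thesis using W that by (simp add: vec.subspace_scale)
        qed
      qed
      moreover have "B \<subseteq> {m. act m w \<in> W}"
        using B(1) W \<open>w \<in> W\<close> by (auto simp: S_def app)
      ultimately have "flat A \<in> {m. act m w \<in> W}"
        using B(3) \<open>A \<in> N\<close> vec.span_minimal[of B "{m. act m w \<in> W}"] by blast
      then show ?thesis by (simp add: app)
    qed
    then show "W = {0} \<or> W = UNIV"
      using assms W unfolding irreducible_matrices_def by blast
  qed
  ultimately show ?thesis by (rule that)
qed

section \<open>Nilpotent and locally nilpotent groups\<close>

text \<open>
  The lower central series is defined for monoid records without further fields; this locale fixes the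
  type of the group accordingly.
\<close>

locale plain_group = group G for G :: "'g monoid" (structure)
begin

lemma subgroup_lower_central_series: "subgroup (lower_central_series G n) G"
proof (induction n)
  case 0
  then show ?case by (simp add: subgroup_self)
next
  case (Suc n)
  show ?case
    unfolding lower_central_series.simps
    by (rule generate_is_subgroup) (use subgroup.subset[OF Suc] in auto)
qed

lemma commutator_in_lower_central_series:
  assumes "x \<in> lower_central_series G n" "y \<in> carrier G"
  shows "x \<otimes> y \<otimes> inv x \<otimes> inv y \<in> lower_central_series G (Suc n)"
  unfolding lower_central_series.simps by (rule generate.incl) (use assms in blast)

lemma commutator_mult:
  assumes "x \<in> carrier G" "y \<in> carrier G"
  shows "(x \<otimes> y \<otimes> inv x \<otimes> inv y) \<otimes> y \<otimes> x = x \<otimes> y"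
  using assms by (simp add: m_assoc inv_solve_left)

lemma inv_commutator:
  assumes "x \<in> carrier G" "y \<in> carrier G"
  shows "inv (y \<otimes> x \<otimes> inv y \<otimes> inv x) = x \<otimes> y \<otimes> inv x \<otimes> inv y"
  using assms by (simp add: inv_mult_group m_assoc)

text \<open>
  A descending central filtration bounds the lower central series from above, by induction; \<open>F 0\<close> need not be a
  subgroup, as it is only compared with the whole group.
\<close>

lemma lower_central_series_subset:
  assumes "carrier G \<subseteq> F 0" and "\<And>i. subgroup (F (Suc i)) G"
    and "\<And>i x y. x \<in> F i \<Longrightarrow> x \<in> carrier G \<Longrightarrow> y \<in> carrier G \<Longrightarrow> x \<otimes> y \<otimes> inv x \<otimes> inv y \<in> F (Suc i)"
  shows "lower_central_series G n \<subseteq> F n"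
proof (induction n)
  case 0
  then show ?case using assms(1) by simp
next
  case (Suc n)
  show ?case
    unfolding lower_central_series.simps
  proof (rule generate_subgroup_incl[OF _ assms(2)])
    show "{x \<otimes> y \<otimes> inv x \<otimes> inv y |x y. x \<in> lower_central_series G n \<and> y \<in> carrier G} \<subseteq> F (Suc n)"
      using Suc assms(3) subgroup.subset[OF subgroup_lower_central_series[of n]] by blast
  qed
qed

lemma nilpotent_groupI:
  assumes "carrier G \<subseteq> F 0" and "\<And>i. subgroup (F (Suc i)) G"
    and "\<And>i x y. x \<in> F i \<Longrightarrow> x \<in> carrier G \<Longrightarrow> y \<in> carrier G \<Longrightarrow> x \<otimes> y \<otimes> inv x \<otimes> inv y \<in> F (Suc i)"
    and "F n \<subseteq> {\<one>}"
  shows "nilpotent_group G"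
proof -
  have "lower_central_series G n \<subseteq> {\<one>}"
    using lower_central_series_subset[of F n, OF assms(1-3)] assms(4) by blast
  moreover have "\<one> \<in> lower_central_series G n"
    using subgroup.one_closed[OF subgroup_lower_central_series] .
  ultimately show ?thesis
    unfolding nilpotent_group_def using is_group by blast
qed

text \<open>
  An element outside the center all of whose commutators are central, found in the last
  noncentral term of the lower central series: the commutators of its elements lie in the next term,
  which is central. The commutator is written as a factor \<open>z\<close> with \<open>a x = z x a\<close> to avoid inverses.
\<close>

lemma nilpotent_second_center:
  assumes nil: "nilpotent_group G"
    and "x\<^sub>0 \<in> carrier G" "y\<^sub>0 \<in> carrier G" "x\<^sub>0 \<otimes> y\<^sub>0 \<noteq> y\<^sub>0 \<otimes> x\<^sub>0"
  obtains a y where "a \<in> carrier G" "y \<in> carrier G" "a \<otimes> y \<noteq> y \<otimes> a"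
    and "\<And>x. x \<in> carrier G \<Longrightarrow>
      \<exists>z\<in>carrier G. a \<otimes> x = z \<otimes> x \<otimes> a \<and> (\<forall>w\<in>carrier G. z \<otimes> w = w \<otimes> z)"
proof -
  define central where
    "central n \<longleftrightarrow> (\<forall>z\<in>lower_central_series G n. \<forall>w\<in>carrier G. z \<otimes> w = w \<otimes> z)" for n
  obtain m where "lower_central_series G m = {\<one>}"
    using nil unfolding nilpotent_group_def by blast
  then have "central m" unfolding central_def by simp
  have "\<not> central 0" using assms(2-4) unfolding central_def by auto
  define k where "k = (LEAST n. central n)"
  have "central k" unfolding k_def using \<open>central m\<close> by (rule LeastI)
  then have "k \<noteq> 0" using \<open>\<not> central 0\<close> by metis
  then obtain j where j: "k = Suc j" by (cases k) auto
  have "\<not> central j"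
    using not_less_Least[of j central] j unfolding k_def by simp
  then obtain a y where ay: "a \<in> lower_central_series G j" "y \<in> carrier G" "a \<otimes> y \<noteq> y \<otimes> a"
    unfolding central_def by blast
  have a: "a \<in> carrier G"
    using ay(1) subgroup.subset[OF subgroup_lower_central_series] by blast
  show ?thesis
  proof (rule that[OF a ay(2,3)])
    fix x assume x: "x \<in> carrier G"
    let ?z = "a \<otimes> x \<otimes> inv a \<otimes> inv x"
    have "\<forall>w\<in>carrier G. ?z \<otimes> w = w \<otimes> ?z"
      using commutator_in_lower_central_series[OF ay(1) x] \<open>central k\<close> j unfolding central_def by blast
    moreover have "a \<otimes> x = ?z \<otimes> x \<otimes> a"
      using commutator_mult[OF a x] by simp
    ultimately show "\<exists>z\<in>carrier G. a \<otimes> x = z \<otimes> x \<otimes> a \<and> (\<forall>w\<in>carrier G. z \<otimes> w = w \<otimes> z)"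
      using a x by (intro bexI[of _ ?z] conjI) auto
  qed
qed

lemma iterated_commutator_trivial:
  assumes nil: "nilpotent_group G" and "g \<in> carrier G" "c 0 \<in> carrier G"
    and "\<And>j. c (Suc j) = c j \<otimes> g \<otimes> inv (c j) \<otimes> inv g"
  shows "\<exists>m. c m = \<one>"
proof -
  obtain m where m: "lower_central_series G m = {\<one>}"
    using nil unfolding nilpotent_group_def by blast
  have "c j \<in> lower_central_series G j" for j
  proof (induction j)
    case 0
    then show ?case using assms(3) by simp
  next
    case (Suc j)
    then show ?case unfolding assms(4) using assms(2) by (rule commutator_in_lower_central_series)
  qed
  then show ?thesis using m by blast
qed

lemma nilpotent_generate:
  assumes "subgroup L G" "locally_nilpotent (G\<lparr>carrier := L\<rparr>)" "finite S" "S \<subseteq> L"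
  shows "nilpotent_group (G\<lparr>carrier := generate G S\<rparr>)"
proof -
  have "nilpotent_group (G\<lparr>carrier := L, carrier := generate (G\<lparr>carrier := L\<rparr>) S\<rparr>)"
    using assms(2-4) unfolding locally_nilpotent_def by simp
  then show ?thesis
    using generate_consistent[OF assms(4,1)] by simp
qed

lemma locally_nilpotentI:
  assumes "subgroup L G"
    and "\<And>S. finite S \<Longrightarrow> S \<subseteq> L \<Longrightarrow> nilpotent_group (G\<lparr>carrier := generate G S\<rparr>)"
  shows "locally_nilpotent (G\<lparr>carrier := L\<rparr>)"
  unfolding locally_nilpotent_def
  using assms subgroup_imp_group[OF assms(1)] generate_consistent[OF _ assms(1)] by simp

lemma comm_group_subgroup_iff:
  assumes "subgroup H G"
  shows "comm_group (G\<lparr>carrier := H\<rparr>) \<longleftrightarrow> (\<forall>x\<in>H. \<forall>y\<in>H. x \<otimes> y = y \<otimes> x)"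
proof
  assume "comm_group (G\<lparr>carrier := H\<rparr>)"
  then interpret H: comm_group "G\<lparr>carrier := H\<rparr>" .
  show "\<forall>x\<in>H. \<forall>y\<in>H. x \<otimes> y = y \<otimes> x" using H.m_comm by simp
next
  assume "\<forall>x\<in>H. \<forall>y\<in>H. x \<otimes> y = y \<otimes> x"
  then show "comm_group (G\<lparr>carrier := H\<rparr>)"
    using subgroup_imp_group[OF assms] by (intro group.group_comm_groupI) auto
qed

text \<open>
  The terms of the filtration may be subgroups of the ambient group that are not contained in \<open>N\<close>.
\<close>

lemma nilpotent_subgroupI:
  assumes N: "subgroup N G" and "N \<subseteq> F 0" and F: "\<And>i. subgroup (F (Suc i)) G"
    and comm: "\<And>i x y. x \<in> F i \<Longrightarrow> x \<in> N \<Longrightarrow> y \<in> N \<Longrightarrow> x \<otimes> y \<otimes> inv x \<otimes> inv y \<in> F (Suc i)"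
    and "F n \<subseteq> {\<one>}"
  shows "nilpotent_group (G\<lparr>carrier := N\<rparr>)"
proof -
  interpret N: plain_group "G\<lparr>carrier := N\<rparr>" by (rule plain_group.intro[OF subgroup_imp_group[OF N]])
  show ?thesis
  proof (rule N.nilpotent_groupI[of "\<lambda>i. F i \<inter> N" n])
    show "subgroup (F (Suc i) \<inter> N) (G\<lparr>carrier := N\<rparr>)" for i
      using subgroup_incl[OF subgroups_Inter_pair[OF F N] N] by simp
    show "x \<otimes>\<^bsub>G\<lparr>carrier := N\<rparr>\<^esub> y \<otimes>\<^bsub>G\<lparr>carrier := N\<rparr>\<^esub> inv\<^bsub>G\<lparr>carrier := N\<rparr>\<^esub> x \<otimes>\<^bsub>G\<lparr>carrier := N\<rparr>\<^esub> inv\<^bsub>G\<lparr>carrier := N\<rparr>\<^esub> y \<in> F (Suc i) \<inter> N"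
      if "x \<in> F i \<inter> N" "x \<in> carrier (G\<lparr>carrier := N\<rparr>)" "y \<in> carrier (G\<lparr>carrier := N\<rparr>)" for i x y
      using that comm m_inv_consistent[OF N] subgroup.m_closed[OF N] subgroup.m_inv_closed[OF N] by simp
  qed (use assms in auto)
qed

lemma abelian_locally_nilpotent:
  assumes H: "subgroup H G" and "comm_group (G\<lparr>carrier := H\<rparr>)"
  shows "locally_nilpotent (G\<lparr>carrier := H\<rparr>)"
proof (rule locally_nilpotentI[OF H])
  fix S assume S: "finite S" "S \<subseteq> H"
  let ?N = "generate G S"
  have sub: "subgroup ?N G"
    using S(2) subgroup.subset[OF H] by (intro generate_is_subgroup) blast
  have "?N \<subseteq> H" using generate_subgroup_incl[OF S(2) H] .
  then have comm: "x \<otimes> y = y \<otimes> x" if "x \<in> ?N" "y \<in> ?N" for x y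
    using that assms(2) unfolding comm_group_subgroup_iff[OF H] by blast
  show "nilpotent_group (G\<lparr>carrier := ?N\<rparr>)"
  proof (rule nilpotent_subgroupI[of _ "\<lambda>i. if i = 0 then ?N else {\<one>}" 1])
    show "x \<otimes> y \<otimes> inv x \<otimes> inv y \<in> (if Suc i = 0 then ?N else {\<one>})"
      if "x \<in> ?N" "y \<in> ?N" for x y i
    proof -
      have "x \<in> carrier G" "y \<in> carrier G" using that subgroup.subset[OF sub] by blast+
      then show ?thesis using comm[OF that] by (simp add: m_assoc)
    qed
  qed (use sub triv_subgroup in auto)
qed

end

lemma (in comm_group) p_group_quotient_iff:
  assumes N: "subgroup N G" and p: "prime p"
  shows "p_group p (G Mod N) \<longleftrightarrow> (\<forall>x\<in>carrier G. \<exists>k. x [^] (p ^ k) \<in> N)"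
proof -
  have "N \<lhd> G" using N by (simp add: normal_iff_subgroup)
  then interpret N: normal N G .
  interpret Q: group "G Mod N" by (rule N.factorgroup_is_group)
  have "(\<exists>k. group.ord (G Mod N) (N #> x) = p ^ k) \<longleftrightarrow> (\<exists>k. x [^] (p ^ k) \<in> N)"
    if x: "x \<in> carrier G" for x
  proof -
    have Nx: "N #> x \<in> carrier (G Mod N)" using x by (simp add: carrier_FactGroup)
    have "x [^] n \<in> N \<longleftrightarrow> group.ord (G Mod N) (N #> x) dvd n" for n :: nat
    proof -
      have "group.ord (G Mod N) (N #> x) dvd n \<longleftrightarrow> N #> (x [^] n) = N"
        using Q.pow_eq_id[OF Nx, of n] N.FactGroup_pow[OF x, of n] by simp
      also have "\<dots> \<longleftrightarrow> x [^] n \<in> N"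
        using x N by (metis coset_join1 coset_join2 nat_pow_closed subgroup.subset)
      finally show ?thesis by simp
    qed
    then show ?thesis
      using p by (metis dvd_refl divides_primepow_nat)
  qed
  then show ?thesis
    unfolding p_group_def using Q.is_group by (simp add: carrier_FactGroup)
qed

section \<open>Irreducible nilpotent groups and maximal abelian groups of matrices\<close>

interpretation GL: plain_group "GL :: ('a::field^'n^'n) monoid"
  by (rule plain_group.intro[OF group_GL])

lemma GL_mult [simp]: "A \<otimes>\<^bsub>GL\<^esub> B = A ** B"
  and GL_one [simp]: "\<one>\<^bsub>GL\<^esub> = mat 1"
  and GL_carrier [simp]: "A \<in> carrier GL \<longleftrightarrow> invertible A"
  by (simp_all add: GL_def)

lemma GL_inv:
  assumes "invertible A"
  shows "A ** inv\<^bsub>GL\<^esub> A = mat 1" "inv\<^bsub>GL\<^esub> A ** A = mat 1" "invertible (inv\<^bsub>GL\<^esub> A)"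
  using GL.r_inv[of A] GL.l_inv[of A] GL.inv_closed[of A] assms by simp_all

lemma invertible_cancel_right:
  fixes A B g :: "'a::field^'n^'n"
  assumes "invertible g" "A ** g = B ** g"
  shows "A = B"
proof -
  have "(A ** g) ** inv\<^bsub>GL\<^esub> g = (B ** g) ** inv\<^bsub>GL\<^esub> g" using assms(2) by simp
  then show ?thesis using assms(1) by (simp add: matrix_mul_assoc[symmetric] GL_inv)
qed

lemma det_mat: "det (mat c :: 'a::field^'n^'n) = c ^ CARD('n)"
  by (subst det_diagonal) (simp_all add: mat_def)

lemma invertible_mat: "invertible (mat c :: 'a::field^'n^'n) \<longleftrightarrow> c \<noteq> 0"
  by (simp add: invertible_det_nz det_mat)

lemma scalar_matrices_iff: "A \<in> scalar_matrices \<longleftrightarrow> (\<exists>c. A = mat c \<and> c \<noteq> 0)"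
  unfolding scalar_matrices_def field_units_def by auto

lemma irreducible_mono:
  "irreducible_matrices S \<Longrightarrow> S \<subseteq> T \<Longrightarrow> irreducible_matrices T"
  unfolding irreducible_matrices_def by blast

text \<open>
  Compare determinants.
\<close>

lemma scalar_commutator_root_of_unity:
  fixes a :: "'a::field^'n^'n"
  assumes "invertible a" "invertible y" "a ** y = mat l ** y ** a"
  shows "l ^ CARD('n) = 1"
proof -
  have "det a * det y = l ^ CARD('n) * det y * det a"
    using arg_cong[OF assms(3), of det] by (simp add: det_mul det_mat)
  then show ?thesis
    using assms(1,2) by (simp add: invertible_det_nz)
qed

lemma centralizer_commutative_GL:
  fixes Z :: "'a::field^'n^'n"
  assumes N: "subgroup N GL" and "irreducible_matrices N" and "prime CARD('n)"
    and "\<And>A. A \<in> N \<Longrightarrow> A ** Z = Z ** A" and "Z \<notin> range mat"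
    and "X ** Z = Z ** X" and "Y ** Z = Z ** Y"
  shows "X ** Y = Y ** X"
proof (rule centralizer_commutative[OF assms(2) _ _ _ assms(4,3,5-7)])
  show "A ** B \<in> N" if "A \<in> N" "B \<in> N" for A B using subgroup.m_closed[OF N that] by simp
  show "mat 1 \<in> N" using subgroup.one_closed[OF N] by simp
  show "invertible A" if "A \<in> N" for A using subgroup.subset[OF N] that by auto
qed

text \<open>
  The center of \<open>N\<close> consists of scalars, because the centralizer of a nonscalar central element would
  be a commutative set containing \<open>N\<close>. So the commutators of a second-center element are scalars.
\<close>

lemma nilpotent_scalar_commutator:
  fixes N :: "('a::field^'n^'n) set"
  assumes N: "subgroup N GL" and irr: "irreducible_matrices N" and prime: "prime CARD('n)"
    and nil: "nilpotent_group (GL\<lparr>carrier := N\<rparr>)"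
    and xy: "x\<^sub>0 \<in> N" "y\<^sub>0 \<in> N" "x\<^sub>0 ** y\<^sub>0 \<noteq> y\<^sub>0 ** x\<^sub>0"
  obtains a y where "a \<in> N" "y \<in> N" "a ** y \<noteq> y ** a"
    and "\<And>x. x \<in> N \<Longrightarrow> \<exists>l. a ** x = mat l ** x ** a"
proof -
  interpret N: plain_group "GL\<lparr>carrier := N\<rparr>"
    by (rule plain_group.intro[OF GL.subgroup_imp_group[OF N]])
  obtain a y where ay: "a \<in> N" "y \<in> N" "a ** y \<noteq> y ** a"
    and z: "\<And>x. x \<in> N \<Longrightarrow> \<exists>z\<in>N. a ** x = z ** x ** a \<and> (\<forall>w\<in>N. z ** w = w ** z)"
    using N.nilpotent_second_center[OF nil, of x\<^sub>0 y\<^sub>0] xy by auto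
  have "\<exists>l. a ** x = mat l ** x ** a" if x: "x \<in> N" for x
  proof -
    obtain z where z: "z \<in> N" "a ** x = z ** x ** a" "\<forall>w\<in>N. z ** w = w ** z"
      using z[OF x] by blast
    have "z \<in> range mat"
    proof (rule ccontr)
      assume "z \<notin> range mat"
      from centralizer_commutative_GL[OF N irr prime _ this, of x\<^sub>0 y\<^sub>0] z(3) xy
      show False by metis
    qed
    then show ?thesis using z(2) by blast
  qed
  then show ?thesis by (rule that[OF ay])
qed

text \<open>
  Two noncommuting elements and a finite irreducible subset of \<open>L\<close> generate a subgroup that is nilpotent,
  irreducible and nonabelian; its scalar commutators have determinant one.
\<close>

lemma locally_nilpotent_root_of_unity:
  fixes L :: "('a::field^'n^'n) set"
  assumes L: "subgroup L GL" and irr: "irreducible_matrices L" and prime: "prime CARD('n)"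
    and nil: "locally_nilpotent (GL\<lparr>carrier := L\<rparr>)"
    and nonabelian: "\<not> comm_group (GL\<lparr>carrier := L\<rparr>)"
  shows "\<exists>l::'a. l \<noteq> 1 \<and> l ^ CARD('n) = 1"
proof -
  obtain x y where xy: "x \<in> L" "y \<in> L" "x ** y \<noteq> y ** x"
    using nonabelian unfolding GL.comm_group_subgroup_iff[OF L] by auto
  obtain S where S: "finite S" "S \<subseteq> L" "irreducible_matrices S"
    using finite_irreducible_subset[OF irr] .
  let ?S = "insert x (insert y S)"
  let ?N = "generate GL ?S"
  have sub: "subgroup ?N GL"
    using S(2) xy(1,2) subgroup.subset[OF L] by (intro GL.generate_is_subgroup) blast
  have incl: "?S \<subseteq> ?N" by (auto intro: generate.incl)
  have "nilpotent_group (GL\<lparr>carrier := ?N\<rparr>)"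
    using S(1,2) xy(1,2) by (intro GL.nilpotent_generate[OF L nil]) auto
  moreover have "irreducible_matrices ?N"
    using irreducible_mono[OF S(3), of ?N] incl by blast
  moreover have "x \<in> ?N" "y \<in> ?N" using incl by auto
  ultimately obtain a b where ab: "a \<in> ?N" "b \<in> ?N" "a ** b \<noteq> b ** a"
    and "\<And>x. x \<in> ?N \<Longrightarrow> \<exists>l. a ** x = mat l ** x ** a"
    using nilpotent_scalar_commutator[OF sub _ prime _ _ _ xy(3)] by metis
  then obtain l where l: "a ** b = mat l ** b ** a" by blast
  have "invertible a" "invertible b" using ab(1,2) subgroup.subset[OF sub] by auto
  then have "l ^ CARD('n) = 1" using l by (rule scalar_commutator_root_of_unity)
  moreover have "l \<noteq> 1" using ab(3) l by auto
  ultimately show ?thesis by blast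
qed

lemma pow_field_units: "x [^]\<^bsub>field_units\<^esub> (n::nat) = x ^ n" for x :: "'a::field"
proof -
  interpret comm_group "field_units :: 'a monoid" by (rule comm_group_field_units)
  show ?thesis by (induction n) (simp_all add: field_units_def mult.commute)
qed

lemma ord_field_units_prime_iff:
  fixes x :: "'a::field"
  assumes q: "prime q" and x: "x \<noteq> 0"
  shows "group.ord field_units x = q \<longleftrightarrow> x \<noteq> 1 \<and> x ^ q = 1"
proof -
  interpret U: comm_group "field_units :: 'a monoid" by (rule comm_group_field_units)
  have pow: "x ^ n = 1 \<longleftrightarrow> U.ord x dvd n" for n
    using U.pow_eq_id[of x n] x unfolding pow_field_units by (simp add: field_units_def)
  show ?thesis
    using pow[of 1] pow[of q] q by (auto simp: prime_nat_iff)
qed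

lemma exists_field_units_ord_prime_iff:
  assumes q: "prime q"
  shows "(\<exists>x::'a::field. x \<in> carrier field_units \<and> group.ord field_units x = q) \<longleftrightarrow>
    (\<exists>l::'a. l \<noteq> 1 \<and> l ^ q = 1)"
proof -
  have "l \<noteq> 0" if "l ^ q = 1" for l :: 'a
    using that q by (metis power_0_left prime_gt_0_nat zero_neq_one less_numeral_extra(3))
  then show ?thesis
    using ord_field_units_prime_iff[OF q] by (auto simp: field_units_def)
qed

text \<open>
  Under scalar matrices every line is invariant.
\<close>

lemma irreducible_nonscalar:
  fixes H :: "('a::field^'n^'n) set"
  assumes "irreducible_matrices H" "prime CARD('n)"
  shows "\<exists>Z\<in>H. Z \<notin> range mat"
proof (rule ccontr)
  assume scalars: "\<not> (\<exists>Z\<in>H. Z \<notin> range mat)"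
  obtain v :: "'a^'n" where v: "v \<noteq> 0"
    using exI[of "\<lambda>v. v \<noteq> 0" "vec 1 :: 'a^'n"] by (auto simp: vec_eq_iff)
  have "A *v w \<in> vec.span {v}" if "A \<in> H" "w \<in> vec.span {v}" for A w
    using scalars that vec.span_scale[OF that(2)] by (auto simp: mat_vec)
  then have "vec.span {v} = {0} \<or> vec.span {v} = UNIV"
    using assms(1) vec.subspace_span unfolding irreducible_matrices_def by blast
  then have "vec.span {v} = UNIV"
    using v vec.span_base[of v "{v}"] by blast
  then have "vec.dim (UNIV :: ('a^'n) set) = vec.dim {v}"
    by (metis vec.dim_span)
  also have "\<dots> = 1"
    using v vec.dim_eq_card_independent[of "{v}"] by simp
  finally have "CARD('n) = 1" by (simp only: vec_dim_card)
  then show False using assms(2) by simp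
qed

locale irreducible_maximal_abelian =
  fixes H :: "('a::field^'n^'n) set"
  assumes prime: "prime CARD('n)" and irr: "irreducible_matrices H"
    and maximal: "maximal_abelian_subgroup GL H"
begin

lemma sub: "subgroup H GL"
  using maximal unfolding maximal_subgroup_with_def by blast

lemma invertible: "A \<in> H \<Longrightarrow> invertible A"
  using subgroup.subset[OF sub] by auto

lemma mult_closed: "A \<in> H \<Longrightarrow> B \<in> H \<Longrightarrow> A ** B \<in> H"
  using subgroup.m_closed[OF sub] by simp

lemma commute: "A \<in> H \<Longrightarrow> B \<in> H \<Longrightarrow> A ** B = B ** A"
  using maximal GL.comm_group_subgroup_iff[OF sub] unfolding maximal_subgroup_with_def by auto

text \<open>
  The centralizer of \<open>Z\<close> in \<open>GL\<close> is an abelian group containing \<open>H\<close>, so maximality gives equality. Thus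
  membership in \<open>H\<close> can be tested by commuting with a single nonscalar element.
\<close>

lemma centralizer_of_nonscalar:
  assumes Z: "Z \<in> H" "Z \<notin> range mat"
  shows "H = {X. invertible X \<and> X ** Z = Z ** X}" (is "_ = ?C")
proof -
  have ab: "X ** Y = Y ** X" if "X \<in> ?C" "Y \<in> ?C" for X Y
    using centralizer_commutative_GL[OF sub irr prime commute[OF _ Z(1)] Z(2)] that by blast
  have "subgroup ?C GL"
  proof (rule GL.subgroupI)
    show "?C \<subseteq> carrier GL" by auto
    show "?C \<noteq> {}" using invertible_mat[of 1] by force
    show "inv\<^bsub>GL\<^esub> X \<in> ?C" if X: "X \<in> ?C" for X
    proof -
      have inv: "invertible X" and XZ: "X ** Z = Z ** X" using X by auto
      have "inv\<^bsub>GL\<^esub> X ** Z = inv\<^bsub>GL\<^esub> X ** (Z ** X) ** inv\<^bsub>GL\<^esub> X"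
        by (simp add: matrix_mul_assoc[symmetric] GL_inv[OF inv])
      also have "\<dots> = inv\<^bsub>GL\<^esub> X ** (X ** Z) ** inv\<^bsub>GL\<^esub> X" unfolding XZ ..
      also have "\<dots> = Z ** inv\<^bsub>GL\<^esub> X" by (simp add: matrix_mul_assoc GL_inv[OF inv])
      finally show ?thesis using GL_inv(3)[OF inv] by simp
    qed
    show "X \<otimes>\<^bsub>GL\<^esub> Y \<in> ?C" if XY: "X \<in> ?C" "Y \<in> ?C" for X Y
    proof -
      have "X ** Y ** Z = X ** (Z ** Y)" using XY(2) by (simp add: matrix_mul_assoc[symmetric])
      also have "\<dots> = Z ** X ** Y" using XY(1) by (simp add: matrix_mul_assoc)
      finally have "X ** Y ** Z = Z ** (X ** Y)" by (simp only: matrix_mul_assoc)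
      moreover have "invertible (X ** Y)" using XY by (intro invertible_mult) auto
      ultimately show ?thesis by simp
    qed
  qed
  moreover from this have "comm_group (GL\<lparr>carrier := ?C\<rparr>)"
    unfolding GL.comm_group_subgroup_iff[OF \<open>subgroup ?C GL\<close>] using ab by simp
  moreover have "H \<subseteq> ?C" using commute[OF _ Z(1)] invertible by blast
  ultimately show ?thesis
    using maximal unfolding maximal_subgroup_with_def by blast
qed

lemma nonscalar_centralizer_commutative:
  assumes "Z \<in> H" "Z \<notin> range mat" "X ** Z = Z ** X" "Y ** Z = Z ** Y"
  shows "X ** Y = Y ** X"
  using centralizer_commutative_GL[OF sub irr prime commute[OF _ assms(1)] assms(2-4)] .

text \<open>
  Schur's lemma makes \<open>X\<close> invertible. This is the closure of \<open>H \<union> {0}\<close> under addition in disguise: together with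
  zero, \<open>H\<close> is a field.
\<close>

lemma nonzero_in:
  assumes "X \<noteq> 0" "\<And>A. A \<in> H \<Longrightarrow> A ** X = X ** A"
  shows "X \<in> H"
proof -
  obtain Z where Z: "Z \<in> H" "Z \<notin> range mat"
    using irreducible_nonscalar[OF irr prime] by blast
  have "invertible X" using schur[OF irr assms(2,1)] .
  then show ?thesis
    unfolding centralizer_of_nonscalar[OF Z] using assms(2)[OF Z(1)] by simp
qed

lemma scalar_in: "c \<noteq> 0 \<Longrightarrow> mat c \<in> H"
  using mat_inj[of c 0, where ?'n = 'n] by (intro nonzero_in) (auto simp: mat_comm)

lemma add_one_in:
  assumes "X \<in> H" "X \<notin> range mat"
  shows "mat 1 + X \<in> H"
proof (rule nonzero_in)
  show "mat 1 + X \<noteq> 0"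
  proof
    assume "mat 1 + X = 0"
    then have "X = 0 - mat 1" by (simp add: eq_neg_iff_add_eq_0 add.commute)
    also have "\<dots> = mat (0 - 1)" using mat_diff[of 0 1, where ?'n = 'n] by simp
    finally show False using assms(2) by blast
  qed
  show "A ** (mat 1 + X) = (mat 1 + X) ** A" if "A \<in> H" for A
    using commute[OF that assms(1)] by (simp add: matrix_add_ldistrib matrix_add_right_distrib)
qed

lemma locally_nilpotent: "locally_nilpotent (GL\<lparr>carrier := H\<rparr>)"
  using GL.abelian_locally_nilpotent[OF sub] maximal unfolding maximal_subgroup_with_def by blast

lemma not_abelian_above:
  assumes "H \<subset> L" "subgroup L GL"
  shows "\<not> comm_group (GL\<lparr>carrier := L\<rparr>)"
  using assms maximal unfolding maximal_subgroup_with_def by blast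

lemma maximal_locally_nilpotent_iff:
  "maximal_locally_nilpotent_subgroup GL H \<longleftrightarrow>
    \<not> (\<exists>L. subgroup L GL \<and> locally_nilpotent (GL\<lparr>carrier := L\<rparr>) \<and> H \<subset> L)"
  using sub locally_nilpotent unfolding maximal_subgroup_with_def by blast

end

section \<open>Kummer generators from nilpotent overgroups\<close>

lemma mat_left_commute: "A ** (mat c ** B) = mat c ** (A ** B)" for A B :: "'a::field^'n^'n"
  by (metis mat_comm matrix_mul_assoc)

lemma mat_mult_left: "mat c ** (mat d ** B) = mat (c * d) ** B" for B :: "'a::field^'n^'n"
  by (simp add: matrix_mul_assoc mat_mult)

lemma mat_cancel_left:
  fixes A B :: "'a::field^'n^'n"
  assumes "c \<noteq> 0" "mat c ** A = mat c ** B"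
  shows "A = B"
proof -
  have "mat (inverse c) ** (mat c ** A) = mat (inverse c) ** (mat c ** B)" using assms(2) by simp
  then show ?thesis using assms(1) by (simp add: mat_mult_left)
qed

text \<open>
  A nonscalar matrix and the identity matrix are linearly independent.
\<close>

lemma nonscalar_affine_eq:
  fixes X :: "'a::field^'n^'n"
  assumes X: "X \<notin> range mat" and eq: "mat s + mat r ** X = mat s' + mat r' ** X"
  shows "s = s'" "r = r'"
proof -
  have "mat (r - r') ** X = mat r ** X - mat r' ** X"
    by (simp add: mat_diff[symmetric] matrix_diff_rdistrib)
  also have "\<dots> = mat s' - mat s" using eq by (simp add: algebra_simps)
  finally have *: "mat (r - r') ** X = mat (s' - s)" by (simp add: mat_diff)
  show r: "r = r'"
  proof (rule ccontr)
    assume "r \<noteq> r'"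
    then have "mat (r - r') ** X = mat (r - r') ** mat ((s' - s) / (r - r'))"
      using * by (simp add: mat_mult)
    moreover have "r - r' \<noteq> 0" using \<open>r \<noteq> r'\<close> by simp
    ultimately have "X = mat ((s' - s) / (r - r'))"
      by (rule mat_cancel_left[rotated])
    then show False using X by blast
  qed
  show "s = s'" using * mat_inj[of 0 "s' - s", where ?'n = 'n] unfolding r by simp
qed

lemma quasi_commuting_pow_right:
  fixes g b :: "'a::field^'n^'n"
  assumes "g ** b = mat r ** b ** g"
  shows "g [^]\<^bsub>GL\<^esub> n ** b = mat (r ^ n) ** b ** g [^]\<^bsub>GL\<^esub> n"
proof (induction n)
  case 0
  then show ?case by simp
next
  case (Suc n)
  have "g [^]\<^bsub>GL\<^esub> Suc n ** b = g [^]\<^bsub>GL\<^esub> n ** (g ** b)"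
    by (simp add: matrix_mul_assoc)
  also have "\<dots> = mat r ** (g [^]\<^bsub>GL\<^esub> n ** b) ** g"
    unfolding assms by (simp only: matrix_mul_assoc[symmetric] mat_left_commute[of "g [^]\<^bsub>GL\<^esub> n"])
  also have "\<dots> = mat (r ^ Suc n) ** b ** (g [^]\<^bsub>GL\<^esub> Suc n)"
    unfolding Suc by (simp add: matrix_mul_assoc mat_mult)
  finally show ?case .
qed

text \<open>
  Moving the \<open>n\<close> factors \<open>g\<close> to the right past the factors \<open>b\<close> produces \<open>0 + 1 + \<dots> + (n - 1)\<close> factors \<open>r\<close>.
\<close>

lemma quasi_commuting_pow_mult:
  fixes g b :: "'a::field^'n^'n"
  assumes "g ** b = mat r ** b ** g"
  shows "(b ** g) [^]\<^bsub>GL\<^esub> n = mat (r ^ (\<Sum>i<n. i)) ** b [^]\<^bsub>GL\<^esub> n ** g [^]\<^bsub>GL\<^esub> n"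
proof (induction n)
  case 0
  then show ?case by simp
next
  case (Suc n)
  let ?s = "\<Sum>i<n. i"
  have "(b ** g) [^]\<^bsub>GL\<^esub> Suc n = mat (r ^ ?s) ** b [^]\<^bsub>GL\<^esub> n ** (g [^]\<^bsub>GL\<^esub> n ** b) ** g"
    using Suc by (simp add: matrix_mul_assoc)
  also have "\<dots> = mat (r ^ ?s) ** (b [^]\<^bsub>GL\<^esub> n ** mat (r ^ n)) ** b ** g [^]\<^bsub>GL\<^esub> n ** g"
    unfolding quasi_commuting_pow_right[OF assms] by (simp add: matrix_mul_assoc)
  also have "\<dots> = mat (r ^ ?s * r ^ n) ** b [^]\<^bsub>GL\<^esub> Suc n ** g [^]\<^bsub>GL\<^esub> Suc n"
    unfolding mat_comm[of "r ^ n" "b [^]\<^bsub>GL\<^esub> n", symmetric] by (simp add: matrix_mul_assoc mat_mult)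
  finally show ?case by (simp add: power_add)
qed

lemma intertwining_pow:
  fixes A B d :: "'a::field^'n^'n" and n :: nat
  assumes "A ** d = d ** B"
  shows "A [^]\<^bsub>GL\<^esub> n ** d = d ** B [^]\<^bsub>GL\<^esub> n"
proof (induction n)
  case 0
  then show ?case by simp
next
  case (Suc n)
  have "A [^]\<^bsub>GL\<^esub> Suc n ** d = A [^]\<^bsub>GL\<^esub> n ** (A ** d)" by (simp add: matrix_mul_assoc)
  also have "\<dots> = (A [^]\<^bsub>GL\<^esub> n ** d) ** B" unfolding assms by (rule matrix_mul_assoc)
  also have "\<dots> = d ** B [^]\<^bsub>GL\<^esub> Suc n" unfolding Suc by (simp add: matrix_mul_assoc)
  finally show ?case .
qed

context irreducible_maximal_abelian
begin

text \<open>
  The subgroup generated by a finite irreducible subset of \<open>H\<close>, a nonscalar \<open>h \<in> H\<close>, the matrix \<open>1 + h\<close> and an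
  element outside \<open>H\<close> is nilpotent and nonabelian, which provides \<open>a\<close> with scalar commutators. This \<open>a\<close>
  turns out to lie in \<open>H\<close>: conjugation by \<open>a\<close> multiplies both \<open>h\<close> and \<open>1 + h\<close> by scalars, which must be equal
  to one since \<open>1\<close> and \<open>h\<close> are linearly independent. That is why \<open>1 + h\<close> is put among the generators.
\<close>

lemma locally_nilpotent_above_twisted:
  assumes L: "subgroup L GL" and nil: "locally_nilpotent (GL\<lparr>carrier := L\<rparr>)" and "H \<subset> L"
  obtains a g l where "a \<in> H" "g \<in> L" "l \<noteq> 1" "g ** a = mat l ** a ** g"
proof -
  obtain g\<^sub>0 where g0: "g\<^sub>0 \<in> L" "g\<^sub>0 \<notin> H" using \<open>H \<subset> L\<close> by blast
  obtain h where h: "h \<in> H" "h \<notin> range mat"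
    using irreducible_nonscalar[OF irr prime] by blast
  have inv0: "invertible g\<^sub>0" using g0(1) subgroup.subset[OF L] by auto
  have g0h: "g\<^sub>0 ** h \<noteq> h ** g\<^sub>0"
    using g0(2) inv0 unfolding centralizer_of_nonscalar[OF h] by blast
  obtain S where S: "finite S" "S \<subseteq> H" "irreducible_matrices S"
    using finite_irreducible_subset[OF irr] .
  let ?S = "insert g\<^sub>0 (insert h (insert (mat 1 + h) S))"
  let ?N = "generate GL ?S"
  have SL: "?S \<subseteq> L" using S(2) g0(1) h(1) add_one_in[OF h] \<open>H \<subset> L\<close> by blast
  have sub: "subgroup ?N GL"
    using SL subgroup.subset[OF L] by (intro GL.generate_is_subgroup) blast
  have incl: "?S \<subseteq> ?N" by (auto intro: generate.incl)
  have NL: "?N \<subseteq> L" using GL.generate_subgroup_incl[OF SL L] .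
  have "nilpotent_group (GL\<lparr>carrier := ?N\<rparr>)"
    using S(1) SL by (intro GL.nilpotent_generate[OF L nil]) auto
  moreover have "irreducible_matrices ?N"
    using irreducible_mono[OF S(3), of ?N] incl by blast
  moreover have "g\<^sub>0 \<in> ?N" "h \<in> ?N" using incl by auto
  ultimately obtain a y where ay: "a \<in> ?N" "y \<in> ?N" "a ** y \<noteq> y ** a"
    and scalar: "\<And>x. x \<in> ?N \<Longrightarrow> \<exists>l. a ** x = mat l ** x ** a"
    using nilpotent_scalar_commutator[OF sub _ prime _ _ _ g0h] by metis
  have inv: "invertible a" "invertible y" using ay(1,2) subgroup.subset[OF sub] by auto
  have "a ** h = h ** a"
  proof -
    obtain r where r: "a ** h = mat r ** h ** a" using scalar[of h] incl by auto
    obtain m where m: "a ** (mat 1 + h) = mat m ** (mat 1 + h) ** a"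
      using scalar[of "mat 1 + h"] incl by auto
    have "(mat 1 + mat r ** h) ** a = a ** (mat 1 + h)"
      using r by (simp add: matrix_add_ldistrib matrix_add_right_distrib)
    also have "\<dots> = (mat m + mat m ** h) ** a"
      using m by (simp add: matrix_add_ldistrib)
    finally have "mat 1 + mat r ** h = mat m + mat m ** h"
      by (rule invertible_cancel_right[OF inv(1)])
    then have "r = 1" using nonscalar_affine_eq[OF h(2)] by metis
    then show ?thesis using r by simp
  qed
  then have "a \<in> H" using inv(1) unfolding centralizer_of_nonscalar[OF h] by blast
  obtain l where l: "a ** y = mat l ** y ** a" using scalar[OF ay(2)] by blast
  have "l \<noteq> 1" using ay(3) l by auto
  have "l ^ CARD('n) = 1" using inv l by (rule scalar_commutator_root_of_unity)
  then have "l \<noteq> 0" using prime by (metis power_0_left not_prime_0 zero_neq_one)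
  then have "y ** a = mat (inverse l) ** a ** y"
    using l by (simp add: matrix_mul_assoc[symmetric] mat_mult_left)
  moreover have "inverse l \<noteq> 1" using \<open>l \<noteq> 1\<close> by simp
  ultimately show ?thesis using that \<open>a \<in> H\<close> ay(2) NL by blast
qed

end

text \<open>
  In this situation, conjugation by \<open>g\<close>, called \<open>conj\<close> below and written \<open>\<sigma>\<close>
  in the comments, is an automorphism of the field \<open>H \<union> {0}\<close> that generates its
  Galois group over the scalars, and \<open>a\<close> is an eigenvector of \<open>\<sigma>\<close> (a Kummer generator).
\<close>

locale twisted_maximal_abelian = irreducible_maximal_abelian H
  for H :: "('a::field^'n^'n) set" +
  fixes a g :: "'a^'n^'n" and l :: 'a
  assumes a: "a \<in> H" and g: "invertible g" and l: "l \<noteq> 1" and ga: "g ** a = mat l ** a ** g"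
begin

lemma root_of_unity: "l ^ CARD('n) = 1"
  using scalar_commutator_root_of_unity[OF g invertible[OF a] ga] .

lemma l_nonzero: "l \<noteq> 0"
  using root_of_unity prime by (metis power_0_left not_prime_0 zero_neq_one)

lemma a_nonscalar: "a \<notin> range mat"
proof
  assume "a \<in> range mat"
  then obtain c where c: "a = mat c" by blast
  then have "c \<noteq> 0" using invertible[OF a] invertible_mat[of c] by blast
  have "mat c ** g = mat (l * c) ** g"
    using ga unfolding c by (simp add: mat_mult mat_comm[of c g])
  then have "mat c = (mat (l * c) :: 'a^'n^'n)" by (rule invertible_cancel_right[OF g])
  then show False using \<open>c \<noteq> 0\<close> l by (simp add: mat_inj)
qed

definition conj :: "'a^'n^'n \<Rightarrow> 'a^'n^'n" where
  "conj b = g ** b ** inv\<^bsub>GL\<^esub> g"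

lemma conj: "g ** b = conj b ** g"
  by (simp add: conj_def matrix_mul_assoc[symmetric] GL_inv[OF g])

text \<open>
  \<open>\<sigma> b\<close> commutes with \<open>\<sigma> a = l a\<close>, hence with \<open>a\<close>.
\<close>

lemma conj_in:
  assumes b: "b \<in> H"
  shows "conj b \<in> H"
proof -
  have "mat l ** (conj b ** a) ** g = conj b ** (mat l ** a ** g)"
    by (simp only: matrix_mul_assoc[symmetric] mat_left_commute[of "conj b"])
  also have "\<dots> = g ** b ** a" unfolding ga[symmetric] conj[of b] by (rule matrix_mul_assoc)
  also have "\<dots> = (g ** a) ** b" using commute[OF b a] by (simp add: matrix_mul_assoc[symmetric])
  also have "\<dots> = mat l ** a ** (g ** b)" unfolding ga by (simp add: matrix_mul_assoc)
  also have "\<dots> = mat l ** (a ** conj b) ** g" unfolding conj[of b] by (simp add: matrix_mul_assoc)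
  finally have "mat l ** (conj b ** a) = mat l ** (a ** conj b)"
    by (rule invertible_cancel_right[OF g])
  then have "conj b ** a = a ** conj b" by (rule mat_cancel_left[OF l_nonzero])
  moreover have "invertible (conj b)"
    unfolding conj_def using g invertible[OF b] GL_inv(3)[OF g] by (intro invertible_mult) auto
  ultimately show ?thesis
    unfolding centralizer_of_nonscalar[OF a a_nonscalar] by blast
qed

text \<open>
  The fixed field of \<open>\<sigma>\<close> consists of the scalars: both \<open>g\<close> and \<open>a\<close> lie in the centralizer of \<open>b\<close>, which would
  be commutative for nonscalar \<open>b\<close>.
\<close>

lemma commutes_g_scalar:
  assumes "b \<in> H" "g ** b = b ** g"
  shows "b \<in> range mat"
proof (rule ccontr)
  assume "b \<notin> range mat"
  then have "g ** a = a ** g"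
    using nonscalar_centralizer_commutative[OF assms(1) _ assms(2)] commute[OF a assms(1)] by blast
  then have "mat 1 ** a ** g = mat l ** a ** g" using ga by simp
  then have "mat 1 ** a = mat l ** a" by (rule invertible_cancel_right[OF g])
  then have "mat 1 = (mat l :: 'a^'n^'n)" by (rule invertible_cancel_right[OF invertible[OF a]])
  then show False using l by (simp add: mat_inj)
qed

text \<open>
  The automorphism \<open>\<sigma>\<close> multiplies \<open>a\<close> by \<open>l\<close>, a root of unity of order \<open>CARD('n)\<close>, so the corresponding power
  of \<open>g\<close> commutes with \<open>a\<close>.
\<close>

lemma g_pow_degree_in: "g [^]\<^bsub>GL\<^esub> CARD('n) \<in> H"
  using quasi_commuting_pow_right[OF ga, of "CARD('n)"] GL.nat_pow_closed[of g] g
  unfolding centralizer_of_nonscalar[OF a a_nonscalar] by (simp add: root_of_unity)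

end

locale locally_nilpotent_twisted = twisted_maximal_abelian H a g l
  for H :: "('a::field^'n^'n) set" and a g l +
  fixes L
  assumes L: "subgroup L GL" and nil: "locally_nilpotent (GL\<lparr>carrier := L\<rparr>)"
    and HL: "H \<subseteq> L" and gL: "g \<in> L"
begin

text \<open>
  The iterated commutators of \<open>b\<close> with \<open>g\<close>, that is \<open>c (Suc j) = c j / \<sigma> (c j)\<close>, reach the identity because \<open>b\<close> and \<open>g\<close>
  generate a nilpotent group.
\<close>

lemma commutator_chain:
  assumes b: "b \<in> H"
  shows "\<exists>c m. c 0 = b \<and> (\<forall>j. c j \<in> H) \<and> (\<forall>j. c (Suc j) ** g ** c j = c j ** g) \<and> c m = mat 1"
proof -
  let ?comm = "\<lambda>x. x \<otimes>\<^bsub>GL\<^esub> g \<otimes>\<^bsub>GL\<^esub> inv\<^bsub>GL\<^esub> x \<otimes>\<^bsub>GL\<^esub> inv\<^bsub>GL\<^esub> g"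
  define c where "c = rec_nat b (\<lambda>_. ?comm)"
  have c0: "c 0 = b" and cS: "c (Suc j) = ?comm (c j)" for j by (simp_all add: c_def)
  have cH: "c j \<in> H" for j
  proof (induction j)
    case 0
    then show ?case by (simp add: c0 b)
  next
    case (Suc j)
    have "c (Suc j) = c j ** conj (inv\<^bsub>GL\<^esub> (c j))"
      unfolding cS conj_def by (simp add: matrix_mul_assoc)
    then show ?case using Suc subgroup.m_inv_closed[OF sub Suc] conj_in mult_closed by simp
  qed
  let ?N = "generate GL {b, g}"
  have N: "subgroup ?N GL" using g invertible[OF b] by (intro GL.generate_is_subgroup) auto
  interpret N: plain_group "GL\<lparr>carrier := ?N\<rparr>"
    by (rule plain_group.intro[OF GL.subgroup_imp_group[OF N]])
  have gN: "g \<in> ?N" and bN: "b \<in> ?N" by (auto intro: generate.incl)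
  have cN: "c j \<in> ?N" for j
  proof (induction j)
    case 0
    then show ?case by (simp add: c0 bN)
  next
    case (Suc j)
    then show ?case unfolding cS
      by (intro subgroup.m_closed[OF N] subgroup.m_inv_closed[OF N] gN)
  qed
  have nilN: "nilpotent_group (GL\<lparr>carrier := ?N\<rparr>)"
    using b HL gL by (intro GL.nilpotent_generate[OF L nil]) auto
  have "\<exists>m. c m = \<one>\<^bsub>GL\<lparr>carrier := ?N\<rparr>\<^esub>"
    by (rule N.iterated_commutator_trivial[OF nilN, of g])
      (use gN bN c0 in \<open>auto simp: GL.m_inv_consistent[OF N cN] GL.m_inv_consistent[OF N gN] cS\<close>)
  then obtain m where "c m = mat 1" by auto
  moreover have "c (Suc j) ** g ** c j = c j ** g" for j
    using GL.commutator_mult[of "c j" g] invertible[OF cH[of j]] g unfolding cS by simp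
  ultimately show ?thesis using c0 cH by blast
qed

text \<open>
  The witness \<open>b\<close> is the last nonscalar term of the commutator chain that starts at \<open>1 + a\<close>. It is an
  eigenvector of \<open>\<sigma>\<close> because the next term \<open>b / \<sigma> b\<close> is a scalar. It is not the initial term,
  because \<open>1 + a\<close> is not an eigenvector; so \<open>b = d / \<sigma> d\<close> for the preceding term \<open>d\<close>, and the norm of \<open>b\<close> is one.
  The norm enters as \<open>(b g) ^ q = N(b) g ^ q\<close> with \<open>q = CARD('n)\<close>: from \<open>b g d = d g\<close> it follows that
  \<open>(b g) ^ q d = d g ^ q = g ^ q d\<close>.
\<close>

lemma norm_one_eigenvector:
  obtains b r where "b \<in> H" "b \<notin> range mat" "r \<noteq> 1" "g ** b = mat r ** b ** g"
    "mat (r ^ (\<Sum>i<CARD('n). i)) ** b [^]\<^bsub>GL\<^esub> CARD('n) = mat 1"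
proof -
  let ?q = "CARD('n)"
  have ba: "mat 1 + a \<in> H" using add_one_in[OF a a_nonscalar] .
  obtain c m where c0: "c 0 = mat 1 + a" and cH: "\<And>j. c j \<in> H"
    and cS: "\<And>j. c (Suc j) ** g ** c j = c j ** g" and cm: "c m = mat 1"
    using commutator_chain[OF ba] by blast
  have step: "g ** c j = mat (inverse u) ** c j ** g" if "c (Suc j) = mat u" "u \<noteq> 0" for j u
  proof -
    have "mat (inverse u) ** (mat u ** g ** c j) = mat (inverse u) ** (c j ** g)"
      using cS[of j] that(1) by simp
    then show ?thesis using that(2) by (simp add: matrix_mul_assoc mat_mult)
  qed
  define j where "j = (LEAST j. c j \<in> range mat)"
  have "c j \<in> range mat" unfolding j_def by (rule LeastI[of _ m]) (simp add: cm)
  then obtain u where u: "c j = mat u" by blast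
  have u0: "u \<noteq> 0" using invertible[OF cH[of j]] invertible_mat[of u] u by metis
  \<comment> \<open>so the last nonscalar term exists\<close>
  have "c 0 \<notin> range mat"
  proof
    assume "c 0 \<in> range mat"
    then obtain s where s: "mat 1 + a = mat s" unfolding c0 by blast
    have "a = (mat 1 + a) - mat 1" by simp
    also have "\<dots> = mat (s - 1)" unfolding s by (rule mat_diff)
    finally show False using a_nonscalar by blast
  qed
  then have "j \<noteq> 0" using u by auto
  then obtain i where i: "j = Suc i" by (cases j) auto
  have nonscalar: "c i \<notin> range mat"
    using not_less_Least[of i "\<lambda>j. c j \<in> range mat"] i unfolding j_def by simp
  define r where "r = inverse u"
  have gci: "g ** c i = mat r ** c i ** g"
    unfolding r_def using step u u0 unfolding i by blast
  have "r \<noteq> 1"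
  proof
    assume "r = 1"
    then show False using commutes_g_scalar[OF cH[of i]] gci nonscalar by simp
  qed
  have "i \<noteq> 0"
  proof
    \<comment> \<open>here \<open>g (1 + a) = (1 + l a) g\<close> would be a scalar multiple of \<open>(1 + a) g\<close>\<close>
    assume "i = 0"
    have "(mat 1 + mat l ** a) ** g = g ** c 0"
      unfolding c0 using ga by (simp add: matrix_add_ldistrib matrix_add_right_distrib)
    also have "\<dots> = (mat r + mat r ** a) ** g"
      using gci unfolding \<open>i = 0\<close> c0 by (simp add: matrix_add_ldistrib)
    finally have "mat 1 + mat l ** a = mat r + mat r ** a"
      by (rule invertible_cancel_right[OF g])
    then show False using nonscalar_affine_eq(1)[OF a_nonscalar] \<open>r \<noteq> 1\<close> by metis
  qed
  then obtain k where k: "i = Suc k" by (cases i) auto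
  let ?b = "c i" and ?d = "c k"
  have "?b ** g ** ?d = ?d ** g" using cS[of k] unfolding k .
  then have "(?b ** g) [^]\<^bsub>GL\<^esub> ?q ** ?d = ?d ** g [^]\<^bsub>GL\<^esub> ?q" by (rule intertwining_pow)
  also have "\<dots> = g [^]\<^bsub>GL\<^esub> ?q ** ?d" by (rule commute[OF cH g_pow_degree_in])
  finally have "(?b ** g) [^]\<^bsub>GL\<^esub> ?q = g [^]\<^bsub>GL\<^esub> ?q"
    by (rule invertible_cancel_right[OF invertible[OF cH]])
  then have "mat (r ^ (\<Sum>i<?q. i)) ** ?b [^]\<^bsub>GL\<^esub> ?q ** g [^]\<^bsub>GL\<^esub> ?q = mat 1 ** g [^]\<^bsub>GL\<^esub> ?q"
    unfolding quasi_commuting_pow_mult[OF gci] by simp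
  then have "mat (r ^ (\<Sum>i<?q. i)) ** ?b [^]\<^bsub>GL\<^esub> ?q = mat 1"
    by (rule invertible_cancel_right[OF invertible[OF g_pow_degree_in]])
  then show ?thesis using that cH nonscalar \<open>r \<noteq> 1\<close> gci by blast
qed

end

section \<open>Consequences of local nilpotency\<close>

lemma root_of_unity_pow_ne_1:
  fixes r :: "'a::field"
  assumes q: "prime q" and r: "r \<noteq> 1" "r ^ q = 1" and i: "0 < i" "i < q"
  shows "r ^ i \<noteq> 1"
proof
  assume "r ^ i = 1"
  interpret U: comm_group "field_units :: 'a monoid" by (rule comm_group_field_units)
  have "r \<noteq> 0" using r(2) q by (metis power_0_left not_prime_0 zero_neq_one)
  then have "r \<in> carrier field_units" by (simp add: field_units_def)
  moreover have "U.ord r = q" using ord_field_units_prime_iff[OF q \<open>r \<noteq> 0\<close>] r by simp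
  ultimately have "q dvd i"
    using U.pow_eq_id[of r i] \<open>r ^ i = 1\<close> unfolding pow_field_units by (simp add: field_units_def)
  then show False using i by (simp add: nat_dvd_not_less)
qed

lemma sum_powers_root_of_unity:
  fixes r :: "'a::field"
  assumes "r \<noteq> 1" "r ^ q = 1"
  shows "(\<Sum>j<q. r ^ j) = 0"
  using assms geometric_sum[of r q] by simp

text \<open>
  In characteristic \<open>q\<close> the equation \<open>r ^ q = 1\<close> reads \<open>(r - 1) ^ q = 0\<close>.
\<close>

lemma of_nat_order_nonzero:
  fixes r :: "'a::field"
  assumes q: "prime q" and r: "r \<noteq> 1" "r ^ q = 1"
  shows "(of_nat q :: 'a) \<noteq> 0"
proof
  assume "(of_nat q :: 'a) = 0"
  then have "CHAR('a) dvd q" by (simp add: of_nat_eq_0_iff_char_dvd)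
  moreover have "CHAR('a) \<noteq> 1" by simp
  ultimately have char: "CHAR('a) = q" using q by (auto simp: prime_nat_iff)
  have "((r - 1) + 1) ^ q = (r - 1) ^ q + 1 ^ q"
    using q char by (intro freshmans_dream) auto
  then show False using r by simp
qed

context irreducible_maximal_abelian
begin

text \<open>
  In the field \<open>H \<union> {0}\<close> the polynomial \<open>x ^ q - 1\<close> has no more than the \<open>q\<close> scalar roots \<open>r ^ i\<close>. The proof avoids
  polynomials: for each \<open>j\<close> the vector \<open>w j\<close>, the sum of \<open>(r ^ j X) ^ i v\<close> over \<open>i < q\<close>, is fixed by \<open>r ^ j X\<close>, so it vanishes
  when \<open>X\<close> has no scalar eigenvalue. But by the orthogonality of the characters of the cyclic group of
  order \<open>q\<close> these vectors add up to \<open>q v\<close>, which is not zero.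
\<close>

lemma root_of_unity_is_scalar:
  fixes r :: 'a
  assumes X: "X \<in> H" and pow: "X [^]\<^bsub>GL\<^esub> CARD('n) = mat 1"
    and r: "r \<noteq> 1" "r ^ CARD('n) = 1"
  shows "X \<in> range mat"
proof (rule ccontr)
  assume nonscalar: "X \<notin> range mat"
  let ?q = "CARD('n)"
  have q0: "0 < ?q" by simp
  obtain v :: "'a^'n" where v: "v \<noteq> 0"
    using exI[of "\<lambda>v. v \<noteq> 0" "vec 1 :: 'a^'n"] by (auto simp: vec_eq_iff)
  define u where "u i = X [^]\<^bsub>GL\<^esub> (i::nat) *v v" for i
  have Xu: "X *v u i = u (Suc i)" for i
    unfolding u_def using GL.nat_pow_Suc2[of X i] invertible[OF X] by (simp add: matrix_vector_mul_assoc)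
  have u0: "u 0 = v" and uq: "u ?q = v" unfolding u_def pow by simp_all
  define w where "w j = (\<Sum>i<?q. (r ^ j) ^ i *s u i)" for j
  have "w j = 0" for j
  proof (rule ccontr)
    assume "w j \<noteq> 0"
    let ?t = "r ^ j"
    have "?t \<noteq> 0" using r(2) q0 by (metis power_eq_0_iff power_0_left less_numeral_extra(3) zero_neq_one)
    \<comment> \<open>the substitution \<open>i\<close> to \<open>Suc i\<close> permutes the summands cyclically\<close>
    have "?t *s (X *v w j) = (\<Sum>i<?q. ?t ^ Suc i *s u (Suc i))"
      unfolding w_def by (simp add: vec.sum vec.scale Xu vec.scale_sum_right)
    also have "\<dots> + u 0 = (\<Sum>i<Suc ?q. ?t ^ i *s u i)"
      by (simp only: sum.lessThan_Suc_shift) (simp add: add.commute)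
    also have "\<dots> = w j + ?t ^ ?q *s u ?q" unfolding w_def by simp
    also have "?t ^ ?q = 1" using r(2) by (metis power_mult mult.commute power_one)
    finally have "?t *s (X *v w j) = w j" unfolding u0 uq by simp
    then have "inverse ?t *s (?t *s (X *v w j)) = inverse ?t *s w j" by simp
    then have "X *v w j = inverse ?t *s w j" using \<open>?t \<noteq> 0\<close> by simp
    then have "X = mat (inverse ?t)"
      using eigenvalue_scalar[OF irr commute[OF _ X]] \<open>w j \<noteq> 0\<close> by blast
    then show False using nonscalar by blast
  qed
  then have "0 = (\<Sum>j<?q. w j)" by simp
  also have "\<dots> = (\<Sum>i<?q. (\<Sum>j<?q. (r ^ i) ^ j) *s u i)"
    unfolding w_def by (subst sum.swap) (simp add: vec.scale_sum_left power_mult[symmetric] mult.commute)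
  also have "\<dots> = (\<Sum>i\<in>{0}. (\<Sum>j<?q. (r ^ i) ^ j) *s u i)"
  proof (rule sum.mono_neutral_right)
    show "\<forall>i\<in>{..<?q} - {0}. (\<Sum>j<?q. (r ^ i) ^ j) *s u i = 0"
    proof
      fix i assume i: "i \<in> {..<?q} - {0}"
      then have "r ^ i \<noteq> 1" by (intro root_of_unity_pow_ne_1[OF prime r]) auto
      moreover have "(r ^ i) ^ ?q = 1" using r(2) by (metis power_mult mult.commute power_one)
      ultimately show "(\<Sum>j<?q. (r ^ i) ^ j) *s u i = 0"
        by (simp add: sum_powers_root_of_unity)
    qed
  qed auto
  also have "\<dots> = of_nat ?q *s v" by (simp add: u0)
  finally have "of_nat ?q *s v = 0" by simp
  then have "(of_nat ?q :: 'a) = 0" using v by (simp only: vec.scale_eq_0_iff simp_thms)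
  then show False using of_nat_order_nonzero[OF prime r] by blast
qed

end

lemma scaled_pow:
  fixes b :: "'a::field^'n^'n" and n :: nat
  shows "(mat w ** b) [^]\<^bsub>GL\<^esub> n = mat (w ^ n) ** b [^]\<^bsub>GL\<^esub> n"
proof (induction n)
  case 0
  then show ?case by simp
next
  case (Suc n)
  have "(mat w ** b) [^]\<^bsub>GL\<^esub> Suc n = mat (w ^ n) ** (b [^]\<^bsub>GL\<^esub> n ** (mat w ** b))"
    by (simp add: Suc matrix_mul_assoc)
  also have "\<dots> = mat (w ^ Suc n) ** b [^]\<^bsub>GL\<^esub> Suc n"
    unfolding mat_left_commute[of "b [^]\<^bsub>GL\<^esub> n"] by (simp add: mat_mult_left mult.commute)
  finally show ?case .
qed

context locally_nilpotent_twisted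
begin

text \<open>
  The eigenvector \<open>b\<close> of norm one satisfies \<open>b ^ q = r ^ -(0 + \<dots> + (q - 1))\<close>. If the base field has a \<open>q\<close>-th
  root \<open>w\<close> of the inverse of the right-hand side, then \<open>w b\<close> is a \<open>q\<close>-th root of unity, hence scalar, although \<open>b\<close> is not. For odd \<open>q\<close>
  the exponent is a multiple of \<open>q\<close>, and \<open>w = 1\<close> will do; for \<open>q = 2\<close> the root is a square root of \<open>r = -1\<close>.
\<close>

lemma degree_2_no_sqrt_minus_1: "CARD('n) = 2 \<and> (\<nexists>i::'a. i\<^sup>2 = - 1)"
proof (rule ccontr)
  assume not_exceptional: "\<not> (CARD('n) = 2 \<and> (\<nexists>i::'a. i\<^sup>2 = - 1))"
  let ?q = "CARD('n)"
  obtain b r where b: "b \<in> H" "b \<notin> range mat" and r: "r \<noteq> 1" "g ** b = mat r ** b ** g"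
    and norm: "mat (r ^ (\<Sum>i<?q. i)) ** b [^]\<^bsub>GL\<^esub> ?q = mat 1"
    by (rule norm_one_eigenvector)
  have rq: "r ^ ?q = 1" using scalar_commutator_root_of_unity[OF g invertible[OF b(1)] r(2)] .
  have "\<exists>w. w ^ ?q = r ^ (\<Sum>i<?q. i)"
  proof (cases "?q = 2")
    case True
    then obtain i :: 'a where "i\<^sup>2 = - 1" using not_exceptional by blast
    moreover have "r\<^sup>2 = 1" using rq True by simp
    then have "r = - 1" using r(1) by (simp add: power2_eq_1_iff)
    ultimately show ?thesis using True by (intro exI[of _ i]) (simp add: numeral_2_eq_2)
  next
    case False
    then have "odd ?q" using prime_odd_nat[OF prime] prime_ge_2_nat[OF prime] by linarith
    then obtain k where k: "?q = 2 * k + 1" by (rule oddE)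
    have "(\<Sum>i<2 * k + 1. i) = (2 * k + 1) * k" by (induction k) auto
    then have "(\<Sum>i<?q. i) = ?q * k" unfolding k .
    then have "1 ^ ?q = r ^ (\<Sum>i<?q. i)" using rq by (simp add: power_mult)
    then show ?thesis by blast
  qed
  then obtain w where w: "w ^ ?q = r ^ (\<Sum>i<?q. i)" by blast
  have "r \<noteq> 0" using rq prime by (metis power_0_left not_prime_0 zero_neq_one)
  then have "w ^ ?q \<noteq> 0" unfolding w by (rule power_not_zero)
  then have "w \<noteq> 0" using prime by (metis power_0_left not_prime_0)
  let ?X = "mat w ** b"
  have "?X \<in> H" using mult_closed[OF scalar_in[OF \<open>w \<noteq> 0\<close>] b(1)] .
  moreover have "?X [^]\<^bsub>GL\<^esub> ?q = mat 1" unfolding scaled_pow w norm ..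
  ultimately have "?X \<in> range mat" using root_of_unity_is_scalar r(1) rq by blast
  then obtain c where "mat w ** b = mat c" by blast
  also have "mat c = mat w ** (mat (c / w) :: 'a^'n^'n)" using \<open>w \<noteq> 0\<close> by (simp add: mat_mult)
  finally have "b = mat (c / w)" by (rule mat_cancel_left[OF \<open>w \<noteq> 0\<close>])
  then show False using b(2) by blast
qed

end

context twisted_maximal_abelian
begin

text \<open>
  The norm of \<open>b\<close> is fixed by \<open>\<sigma>\<close> because \<open>\<sigma>\<close> has order two.
\<close>

lemma norm_scalar:
  assumes q: "CARD('n) = 2" and b: "b \<in> H"
  obtains t where "t \<noteq> 0" "b ** conj b = mat t"
proof -
  have g2: "g ** g \<in> H" using g_pow_degree_in q by (simp add: numeral_2_eq_2)
  have "conj (conj b) ** (g ** g) = g ** conj b ** g"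
    by (simp add: matrix_mul_assoc conj[of "conj b"])
  also have "\<dots> = (g ** g) ** b" by (simp add: matrix_mul_assoc[symmetric] conj[of b])
  also have "\<dots> = b ** (g ** g)" by (rule commute[OF g2 b])
  finally have cc: "conj (conj b) = b" by (rule invertible_cancel_right[OF invertible[OF g2]])
  have "g ** (b ** conj b) = conj b ** (g ** conj b)"
    by (simp add: matrix_mul_assoc conj[of b])
  also have "\<dots> = (conj b ** b) ** g"
    unfolding conj[of "conj b"] cc by (rule matrix_mul_assoc)
  also have "\<dots> = (b ** conj b) ** g" using commute[OF conj_in[OF b] b] by simp
  finally have "g ** (b ** conj b) = (b ** conj b) ** g" .
  moreover have bcH: "b ** conj b \<in> H" using mult_closed[OF b conj_in[OF b]] .
  ultimately obtain t where t: "b ** conj b = mat t" using commutes_g_scalar by blast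
  moreover have "t \<noteq> 0" using invertible[OF bcH] unfolding t by (simp add: invertible_mat)
  ultimately show ?thesis using that by blast
qed

end

text \<open>
  In degree two, \<open>\<sigma>\<close> inverts \<open>H\<close> modulo scalars, so each step \<open>c / \<sigma> c\<close> of the commutator chain squares modulo
  scalars, and the \<open>2 ^ m\<close>-th power of \<open>b\<close> is a scalar when the chain ends after \<open>m\<close> steps.
\<close>

lemma (in locally_nilpotent_twisted) two_power_scalar:
  assumes q: "CARD('n) = 2" and b: "b \<in> H"
  shows "\<exists>k. b [^]\<^bsub>GL\<^esub> ((2::nat) ^ k) \<in> range mat"
proof -
  obtain c m where c0: "c 0 = b" and cH: "\<And>j. c j \<in> H"
    and cS: "\<And>j. c (Suc j) ** g ** c j = c j ** g" and cm: "c m = mat 1"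
    using commutator_chain[OF b] by blast
  have square: "\<exists>t. c j ** c j = mat t ** c (Suc j)" for j
  proof -
    obtain t where t: "c j ** conj (c j) = mat t" using norm_scalar[OF q cH[of j]] by metis
    have "c (Suc j) ** conj (c j) ** g = c j ** g"
      using cS[of j] by (simp add: matrix_mul_assoc[symmetric] conj[of "c j"])
    then have *: "c (Suc j) ** conj (c j) = c j" by (rule invertible_cancel_right[OF g])
    have "c j ** c j = (c (Suc j) ** conj (c j)) ** c j" unfolding * ..
    also have "\<dots> = c (Suc j) ** (c j ** conj (c j))"
      using commute[OF conj_in[OF cH[of j]] cH[of j]] by (simp add: matrix_mul_assoc[symmetric])
    also have "\<dots> = mat t ** c (Suc j)" unfolding t by (rule mat_comm[symmetric])
    finally show ?thesis by blast
  qed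
  have "\<exists>s. b [^]\<^bsub>GL\<^esub> ((2::nat) ^ j) = mat s ** c j" for j
  proof (induction j)
    case 0
    then show ?case using c0 by (intro exI[of _ 1]) simp
  next
    case (Suc j)
    then obtain s where s: "b [^]\<^bsub>GL\<^esub> ((2::nat) ^ j) = mat s ** c j" by blast
    obtain t where t: "c j ** c j = mat t ** c (Suc j)" using square by blast
    have "b [^]\<^bsub>GL\<^esub> ((2::nat) ^ Suc j) = b [^]\<^bsub>GL\<^esub> ((2::nat) ^ j) ** b [^]\<^bsub>GL\<^esub> ((2::nat) ^ j)"
      using GL.nat_pow_mult[of b "2 ^ j" "2 ^ j"] invertible[OF b] by (simp add: mult_2)
    also have "\<dots> = mat s ** (mat s ** (c j ** c j))"
      unfolding s by (metis matrix_mul_assoc mat_left_commute)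
    also have "\<dots> = mat (s * s * t) ** c (Suc j)"
      unfolding t by (simp add: mat_mult_left mult.assoc)
    finally show ?case by blast
  qed
  from this[of m] show ?thesis unfolding cm by auto
qed

section \<open>A locally nilpotent overgroup in degree two\<close>

context twisted_maximal_abelian
begin

lemma conj_mult: "conj b ** conj c = conj (b ** c)"
proof -
  have "conj b ** conj c ** g = g ** b ** c"
    by (simp add: matrix_mul_assoc[symmetric] conj[of c, symmetric])
      (simp add: matrix_mul_assoc conj[of b, symmetric])
  also have "\<dots> = conj (b ** c) ** g" by (simp add: matrix_mul_assoc[symmetric] conj[of "b ** c", symmetric])
  finally show ?thesis by (rule invertible_cancel_right[OF g])
qed

lemma conj_mat: "conj (mat c) = mat c"
  by (simp add: conj_def mat_comm[of c g, symmetric] matrix_mul_assoc[symmetric] GL_inv[OF g])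

text \<open>
  For a \<open>\<sigma>\<close>-invariant subgroup \<open>B\<close> of \<open>H\<close> containing \<open>g ** g\<close> this is the subgroup generated by \<open>B\<close> and \<open>g\<close>.
\<close>

definition adjoin :: "('a^'n^'n) set \<Rightarrow> ('a^'n^'n) set" where
  "adjoin B = B \<union> (\<lambda>h. h ** g) ` B"

lemma subgroup_adjoin:
  assumes B: "subgroup B GL" "B \<subseteq> H" and conjB: "\<And>b. b \<in> B \<Longrightarrow> conj b \<in> B" and g2: "g ** g \<in> B"
  shows "subgroup (adjoin B) GL"
proof (rule GL.subgroupI)
  have mult: "x ** y \<in> B" if "x \<in> B" "y \<in> B" for x y
    using subgroup.m_closed[OF B(1) that] by simp
  have inv: "inv\<^bsub>GL\<^esub> x \<in> B" if "x \<in> B" for x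
    using subgroup.m_inv_closed[OF B(1) that] .
  have invB: "invertible x" if "x \<in> B" for x
    using subgroup.subset[OF B(1)] that by auto
  show "adjoin B \<subseteq> carrier GL"
    using invB invertible_mult[OF invB g] unfolding adjoin_def by auto
  show "adjoin B \<noteq> {}"
    using subgroup.one_closed[OF B(1)] unfolding adjoin_def by blast
  show "x \<otimes>\<^bsub>GL\<^esub> y \<in> adjoin B" if xy: "x \<in> adjoin B" "y \<in> adjoin B" for x y
  proof -
    consider "x \<in> B" "y \<in> B" | h where "x \<in> B" "h \<in> B" "y = h ** g"
      | h where "h \<in> B" "y \<in> B" "x = h ** g" | h h' where "h \<in> B" "h' \<in> B" "x = h ** g" "y = h' ** g"
      using xy unfolding adjoin_def by blast
    then show ?thesis
    proof cases
      case 1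
      then show ?thesis using mult unfolding adjoin_def by simp
    next
      case (2 h)
      then have "x ** y = (x ** h) ** g" by (simp add: matrix_mul_assoc)
      then show ?thesis using mult[OF 2(1,2)] unfolding adjoin_def by simp
    next
      case (3 h)
      then have "x ** y = (h ** conj y) ** g" by (simp add: matrix_mul_assoc[symmetric] conj[of y])
      then show ?thesis using mult[OF 3(1) conjB[OF 3(2)]] unfolding adjoin_def by simp
    next
      case (4 h h')
      then have "x ** y = h ** (g ** h') ** g" by (simp add: matrix_mul_assoc)
      also have "\<dots> = h ** conj h' ** (g ** g)"
        unfolding conj[of h'] by (simp add: matrix_mul_assoc)
      finally show ?thesis using mult[OF mult[OF 4(1) conjB[OF 4(2)]] g2] unfolding adjoin_def by simp
    qed
  qed
  show "inv\<^bsub>GL\<^esub> x \<in> adjoin B" if x: "x \<in> adjoin B" for x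
  proof -
    consider "x \<in> B" | h where "h \<in> B" "x = h ** g" using x unfolding adjoin_def by blast
    then show ?thesis
    proof cases
      case 1
      then show ?thesis using inv unfolding adjoin_def by simp
    next
      case (2 h)
      have "inv\<^bsub>GL\<^esub> g = inv\<^bsub>GL\<^esub> (g ** g) ** g"
      proof (rule invertible_cancel_right[OF g])
        show "inv\<^bsub>GL\<^esub> g ** g = inv\<^bsub>GL\<^esub> (g ** g) ** g ** g"
          using GL_inv(2)[OF g] GL_inv(2)[OF invB[OF g2]] by (simp add: matrix_mul_assoc[symmetric])
      qed
      then have "inv\<^bsub>GL\<^esub> x = inv\<^bsub>GL\<^esub> (g ** g) ** (g ** inv\<^bsub>GL\<^esub> h)"
        using GL.inv_mult_group[of h g] invB[OF 2(1)] g 2(2) by (simp add: matrix_mul_assoc)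
      also have "\<dots> = (inv\<^bsub>GL\<^esub> (g ** g) ** conj (inv\<^bsub>GL\<^esub> h)) ** g"
        unfolding conj[of "inv\<^bsub>GL\<^esub> h"] by (rule matrix_mul_assoc)
      finally show ?thesis
        using mult[OF inv[OF g2] conjB[OF inv[OF 2(1)]]] unfolding adjoin_def by blast
    qed
  qed
qed

text \<open>
  The \<open>2 ^ k\<close>-torsion of \<open>H\<close> modulo scalars; \<open>two_power_torsion 0\<close> is the group of nonzero scalars.
\<close>

definition two_power_torsion :: "nat \<Rightarrow> ('a^'n^'n) set" where
  "two_power_torsion k = {b \<in> H. b [^]\<^bsub>GL\<^esub> ((2::nat) ^ k) \<in> range mat}"

lemma two_power_torsion_H: "two_power_torsion k \<subseteq> H"
  unfolding two_power_torsion_def by blast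

lemma scalar_two_power_torsion: "c \<noteq> 0 \<Longrightarrow> mat c \<in> two_power_torsion k"
  using scaled_pow[of c "mat 1 :: 'a^'n^'n" "2 ^ k"] scalar_in[of c]
  unfolding two_power_torsion_def by (simp add: GL.nat_pow_one[simplified])

lemma square_two_power_torsion:
  assumes "b \<in> H"
  shows "b \<in> two_power_torsion (Suc k) \<longleftrightarrow> b ** b \<in> two_power_torsion k"
proof -
  have "(b ** b) [^]\<^bsub>GL\<^esub> ((2::nat) ^ k) = b [^]\<^bsub>GL\<^esub> ((2::nat) ^ Suc k)"
    using GL.nat_pow_pow[of b 2 "2 ^ k"] invertible[OF assms] by (simp add: numeral_2_eq_2)
  then show ?thesis
    using assms mult_closed unfolding two_power_torsion_def by simp
qed

lemma subgroup_two_power_torsion: "subgroup (two_power_torsion k) GL"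
proof (rule GL.subgroupI)
  show "two_power_torsion k \<subseteq> carrier GL" unfolding two_power_torsion_def using invertible by auto
  show "two_power_torsion k \<noteq> {}" using scalar_two_power_torsion[of 1] by auto
  show "inv\<^bsub>GL\<^esub> x \<in> two_power_torsion k" if x: "x \<in> two_power_torsion k" for x
  proof -
    have xH: "x \<in> H" using x unfolding two_power_torsion_def by blast
    obtain c where c: "x [^]\<^bsub>GL\<^esub> ((2::nat) ^ k) = mat c" using x unfolding two_power_torsion_def by blast
    have inv: "invertible (mat c :: 'a^'n^'n)"
      unfolding c[symmetric] using GL.nat_pow_closed[of x "2 ^ k"] invertible[OF xH] by simp
    then have "c \<noteq> 0" by (simp add: invertible_mat)
    have "(inv\<^bsub>GL\<^esub> x) [^]\<^bsub>GL\<^esub> ((2::nat) ^ k) = inv\<^bsub>GL\<^esub> (mat c)"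
      using GL.nat_pow_inv[of x "2 ^ k"] invertible[OF xH] c by simp
    also have "\<dots> = mat (inverse c)"
      using GL.inv_equality[of "mat (inverse c)" "mat c"] \<open>c \<noteq> 0\<close> by (simp add: mat_mult invertible_mat)
    finally show ?thesis
      unfolding two_power_torsion_def using subgroup.m_inv_closed[OF sub xH] by simp
  qed
  show "x \<otimes>\<^bsub>GL\<^esub> y \<in> two_power_torsion k" if xy: "x \<in> two_power_torsion k" "y \<in> two_power_torsion k" for x y
  proof -
    have H: "x \<in> H" "y \<in> H" using xy unfolding two_power_torsion_def by auto
    obtain c d where cd: "x [^]\<^bsub>GL\<^esub> ((2::nat) ^ k) = mat c" "y [^]\<^bsub>GL\<^esub> ((2::nat) ^ k) = mat d"
      using xy unfolding two_power_torsion_def by blast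
    have "(x ** y) [^]\<^bsub>GL\<^esub> ((2::nat) ^ k) = mat (c * d)"
      using GL.pow_mult_distrib[of x y "2 ^ k"] commute[OF H] invertible H cd by (simp add: mat_mult)
    then show ?thesis unfolding two_power_torsion_def using mult_closed[OF H] by simp
  qed
qed

lemma conj_two_power_torsion:
  assumes "b \<in> two_power_torsion k"
  shows "conj b \<in> two_power_torsion k"
proof -
  have bH: "b \<in> H" using assms unfolding two_power_torsion_def by blast
  obtain c where c: "b [^]\<^bsub>GL\<^esub> ((2::nat) ^ k) = mat c" using assms unfolding two_power_torsion_def by blast
  have "conj b [^]\<^bsub>GL\<^esub> ((2::nat) ^ k) ** g = g ** mat c"
    unfolding c[symmetric] using conj[of b, symmetric] by (rule intertwining_pow)
  also have "\<dots> = mat c ** g" by (rule mat_comm[symmetric])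
  finally have "conj b [^]\<^bsub>GL\<^esub> ((2::nat) ^ k) = mat c" by (rule invertible_cancel_right[OF g])
  then show ?thesis unfolding two_power_torsion_def using conj_in[OF bH] by simp
qed

lemma two_power_torsion_Suc: "two_power_torsion k \<subseteq> two_power_torsion (Suc k)"
proof
  fix b assume b: "b \<in> two_power_torsion k"
  then have "b ** b \<in> two_power_torsion k" using subgroup.m_closed[OF subgroup_two_power_torsion b b] by simp
  then show "b \<in> two_power_torsion (Suc k)" using b two_power_torsion_H square_two_power_torsion by blast
qed

lemma two_power_torsion_mono: "k \<le> k' \<Longrightarrow> two_power_torsion k \<subseteq> two_power_torsion k'"
  by (induction rule: dec_induct) (use two_power_torsion_Suc in auto)

lemma commutator_with_coset:
  assumes x: "x \<in> H" and h: "h \<in> H"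
  shows "x \<otimes>\<^bsub>GL\<^esub> (h ** g) \<otimes>\<^bsub>GL\<^esub> inv\<^bsub>GL\<^esub> x \<otimes>\<^bsub>GL\<^esub> inv\<^bsub>GL\<^esub> (h ** g) = x ** conj (inv\<^bsub>GL\<^esub> x)"
proof -
  have inv: "invertible x" "invertible (h ** g)"
    using invertible[OF x] invertible_mult[OF invertible[OF h] g] by auto
  have xi: "inv\<^bsub>GL\<^esub> x \<in> H" using subgroup.m_inv_closed[OF sub x] .
  have "x ** (h ** g) ** inv\<^bsub>GL\<^esub> x = x ** h ** (g ** inv\<^bsub>GL\<^esub> x)" by (simp add: matrix_mul_assoc)
  also have "\<dots> = x ** (h ** conj (inv\<^bsub>GL\<^esub> x)) ** g"
    unfolding conj[of "inv\<^bsub>GL\<^esub> x"] by (simp add: matrix_mul_assoc)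
  also have "\<dots> = x ** conj (inv\<^bsub>GL\<^esub> x) ** (h ** g)"
    unfolding commute[OF h conj_in[OF xi]] by (simp add: matrix_mul_assoc)
  finally have "x ** (h ** g) ** inv\<^bsub>GL\<^esub> x ** inv\<^bsub>GL\<^esub> (h ** g) = x ** conj (inv\<^bsub>GL\<^esub> x) ** ((h ** g) ** inv\<^bsub>GL\<^esub> (h ** g))"
    by (simp add: matrix_mul_assoc)
  also have "\<dots> = x ** conj (inv\<^bsub>GL\<^esub> x)" unfolding GL_inv(1)[OF inv(2)] by simp
  finally show ?thesis by simp
qed

text \<open>
  Since \<open>x (\<sigma> x)\<close> is a scalar, \<open>x / \<sigma> x\<close> is \<open>x ** x\<close> up to a scalar.
\<close>

lemma commutator_descends:
  assumes q: "CARD('n) = 2" and x: "x \<in> two_power_torsion (Suc k)" and y: "y \<in> adjoin H"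
  shows "x \<otimes>\<^bsub>GL\<^esub> y \<otimes>\<^bsub>GL\<^esub> inv\<^bsub>GL\<^esub> x \<otimes>\<^bsub>GL\<^esub> inv\<^bsub>GL\<^esub> y \<in> two_power_torsion k"
proof -
  have xH: "x \<in> H" using x two_power_torsion_H by blast
  consider "y \<in> H" | h where "h \<in> H" "y = h ** g" using y unfolding adjoin_def by blast
  then show ?thesis
  proof cases
    case 1
    then have "x \<otimes>\<^bsub>GL\<^esub> y = y \<otimes>\<^bsub>GL\<^esub> x" using commute[OF xH] by simp
    then have "x \<otimes>\<^bsub>GL\<^esub> y \<otimes>\<^bsub>GL\<^esub> inv\<^bsub>GL\<^esub> x \<otimes>\<^bsub>GL\<^esub> inv\<^bsub>GL\<^esub> y = \<one>\<^bsub>GL\<^esub>"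
      using invertible[OF xH] invertible[OF 1] by (simp add: matrix_mul_assoc[symmetric] GL_inv)
    then show ?thesis using subgroup.one_closed[OF subgroup_two_power_torsion] by simp
  next
    case (2 h)
    let ?z = "x ** conj (inv\<^bsub>GL\<^esub> x)"
    obtain t where t: "t \<noteq> 0" "x ** conj x = mat t" by (rule norm_scalar[OF q xH])
    have xi: "inv\<^bsub>GL\<^esub> x \<in> H" using subgroup.m_inv_closed[OF sub xH] .
    have "mat t ** ?z = (x ** conj x) ** ?z" unfolding t ..
    also have "\<dots> = (x ** x) ** (conj x ** conj (inv\<^bsub>GL\<^esub> x))"
      using commute[OF conj_in[OF xH] xH] by (metis matrix_mul_assoc)
    also have "\<dots> = x ** x"
      unfolding conj_mult GL_inv(1)[OF invertible[OF xH]] conj_mat by simp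
    finally have "mat (inverse t) ** (mat t ** ?z) = mat (inverse t) ** (x ** x)" by simp
    then have "?z = mat (inverse t) ** (x ** x)" using t(1) by (simp add: mat_mult_left)
    moreover have "x ** x \<in> two_power_torsion k" using x square_two_power_torsion[OF xH] by blast
    moreover have "mat (inverse t) \<in> two_power_torsion k" using t(1) by (intro scalar_two_power_torsion) simp
    ultimately have "?z \<in> two_power_torsion k"
      using subgroup.m_closed[OF subgroup_two_power_torsion] by simp
    then show ?thesis unfolding 2(2) commutator_with_coset[OF xH 2(1)] .
  qed
qed

text \<open>
  The group \<open>adjoin (two_power_torsion k)\<close> has the subgroup \<open>two_power_torsion k\<close> of index two, hence an abelian quotient.
\<close>

lemma commutator_in_two_power_torsion:
  assumes x: "x \<in> adjoin (two_power_torsion k)" and y: "y \<in> adjoin (two_power_torsion k)"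
    and q: "CARD('n) = 2" and g2: "g ** g \<in> two_power_torsion k"
  shows "x \<otimes>\<^bsub>GL\<^esub> y \<otimes>\<^bsub>GL\<^esub> inv\<^bsub>GL\<^esub> x \<otimes>\<^bsub>GL\<^esub> inv\<^bsub>GL\<^esub> y \<in> two_power_torsion k"
proof -
  have AH: "adjoin (two_power_torsion k) \<subseteq> adjoin H" using two_power_torsion_H[of k] unfolding adjoin_def by blast
  have mult: "x ** y \<in> two_power_torsion k" if "x \<in> two_power_torsion k" "y \<in> two_power_torsion k" for x y
    using subgroup.m_closed[OF subgroup_two_power_torsion that] by simp
  have coset_mult: "(h ** g) ** (h' ** g) \<in> two_power_torsion k" if "h \<in> two_power_torsion k" "h' \<in> two_power_torsion k" for h h'
  proof -
    have "(h ** g) ** (h' ** g) = h ** (g ** h') ** g" by (simp add: matrix_mul_assoc)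
    also have "\<dots> = h ** conj h' ** (g ** g)" unfolding conj[of h'] by (simp add: matrix_mul_assoc)
    finally show ?thesis using mult[OF mult[OF that(1) conj_two_power_torsion[OF that(2)]] g2] by simp
  qed
  have inv: "invertible z" if "z \<in> adjoin (two_power_torsion k)" for z
    using that invertible invertible_mult[OF invertible g] two_power_torsion_H[of k] unfolding adjoin_def by auto
  have left: "x \<otimes>\<^bsub>GL\<^esub> y \<otimes>\<^bsub>GL\<^esub> inv\<^bsub>GL\<^esub> x \<otimes>\<^bsub>GL\<^esub> inv\<^bsub>GL\<^esub> y \<in> two_power_torsion k"
    if "x \<in> two_power_torsion k" "y \<in> adjoin (two_power_torsion k)" for x y
    using that two_power_torsion_Suc AH by (intro commutator_descends[OF q]) auto
  consider "x \<in> two_power_torsion k" | "y \<in> two_power_torsion k"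
    | h h' where "h \<in> two_power_torsion k" "h' \<in> two_power_torsion k" "x = h ** g" "y = h' ** g"
    using x y unfolding adjoin_def by blast
  then show ?thesis
  proof cases
    case 1
    then show ?thesis using left y by blast
  next
    case 2
    have "inv\<^bsub>GL\<^esub> (y \<otimes>\<^bsub>GL\<^esub> x \<otimes>\<^bsub>GL\<^esub> inv\<^bsub>GL\<^esub> y \<otimes>\<^bsub>GL\<^esub> inv\<^bsub>GL\<^esub> x) \<in> two_power_torsion k"
      using subgroup.m_inv_closed[OF subgroup_two_power_torsion left[OF 2 x]] .
    moreover have "inv\<^bsub>GL\<^esub> (y \<otimes>\<^bsub>GL\<^esub> x \<otimes>\<^bsub>GL\<^esub> inv\<^bsub>GL\<^esub> y \<otimes>\<^bsub>GL\<^esub> inv\<^bsub>GL\<^esub> x) =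
        x \<otimes>\<^bsub>GL\<^esub> y \<otimes>\<^bsub>GL\<^esub> inv\<^bsub>GL\<^esub> x \<otimes>\<^bsub>GL\<^esub> inv\<^bsub>GL\<^esub> y"
      using inv[OF x] inv[OF y] by (intro GL.inv_commutator) simp_all
    ultimately show ?thesis by simp
  next
    case (3 h h')
    have xy: "x ** y \<in> two_power_torsion k" and yx: "y ** x \<in> two_power_torsion k"
      using coset_mult 3 by auto
    have "x \<otimes>\<^bsub>GL\<^esub> y \<otimes>\<^bsub>GL\<^esub> inv\<^bsub>GL\<^esub> x \<otimes>\<^bsub>GL\<^esub> inv\<^bsub>GL\<^esub> y = (x ** y) \<otimes>\<^bsub>GL\<^esub> inv\<^bsub>GL\<^esub> (y ** x)"
      using GL.inv_mult_group[of y x] inv[OF x] inv[OF y] by (simp add: matrix_mul_assoc)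
    then show ?thesis
      using subgroup.m_closed[OF subgroup_two_power_torsion xy subgroup.m_inv_closed[OF subgroup_two_power_torsion yx]] by simp
  qed
qed

text \<open>
  Finitely many elements lie in \<open>adjoin (two_power_torsion k)\<close> for some \<open>k\<close>. The filtration of this group
  by \<open>two_power_torsion k\<close>, \<dots>, \<open>two_power_torsion 0\<close> and the trivial group is central.
\<close>

lemma adjoin_locally_nilpotent:
  assumes q: "CARD('n) = 2" and two: "\<And>b. b \<in> H \<Longrightarrow> \<exists>k. b \<in> two_power_torsion k"
  shows "subgroup (adjoin H) GL" "locally_nilpotent (GL\<lparr>carrier := adjoin H\<rparr>)"
proof -
  have g2: "g ** g \<in> H" using g_pow_degree_in q by (simp add: numeral_2_eq_2)
  show L: "subgroup (adjoin H) GL"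
    using subgroup_adjoin[OF sub subset_refl conj_in g2] .
  show "locally_nilpotent (GL\<lparr>carrier := adjoin H\<rparr>)"
  proof (rule GL.locally_nilpotentI[OF L])
    fix S assume S: "finite S" "S \<subseteq> adjoin H"
    have adjoin_mono: "adjoin (two_power_torsion k) \<subseteq> adjoin (two_power_torsion k')" if "k \<le> k'" for k k'
      using two_power_torsion_mono[OF that] unfolding adjoin_def by blast
    have "\<exists>k. S \<subseteq> adjoin (two_power_torsion k) \<and> g ** g \<in> two_power_torsion k"
      using S
    proof (induction S rule: finite_induct)
      case empty
      then show ?case using two[OF g2] by simp
    next
      case (insert x S)
      then obtain k where k: "S \<subseteq> adjoin (two_power_torsion k)" "g ** g \<in> two_power_torsion k" by auto
      obtain k' where "x \<in> adjoin (two_power_torsion k')"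
        using insert.prems two unfolding adjoin_def by blast
      then show ?case
        using k adjoin_mono[of k "max k k'"] adjoin_mono[of k' "max k k'"] two_power_torsion_mono[of k "max k k'"]
        by (intro exI[of _ "max k k'"]) auto
    qed
    then obtain k where k: "S \<subseteq> adjoin (two_power_torsion k)" "g ** g \<in> two_power_torsion k" by blast
    let ?N = "generate GL S"
    have N: "subgroup ?N GL"
      using S(2) subgroup.subset[OF L] by (intro GL.generate_is_subgroup) blast
    have Nk: "?N \<subseteq> adjoin (two_power_torsion k)"
      using GL.generate_subgroup_incl[OF k(1) subgroup_adjoin[OF subgroup_two_power_torsion two_power_torsion_H conj_two_power_torsion k(2)]] .
    have NH: "?N \<subseteq> adjoin H" using Nk two_power_torsion_H[of k] unfolding adjoin_def by blast
    have invN: "invertible x" if "x \<in> ?N" for x using subgroup.subset[OF N] that by auto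
    \<comment> \<open>after the group itself, \<open>F\<close> runs through the torsion levels \<open>k\<close>, \<dots>, \<open>0\<close> at the indices \<open>1\<close>, \<dots>, \<open>Suc k\<close>\<close>
    define F where "F i = (if i = 0 then ?N else if i \<le> Suc k then two_power_torsion (Suc k - i) else {mat 1})" for i
    show "nilpotent_group (GL\<lparr>carrier := ?N\<rparr>)"
    proof (rule GL.nilpotent_subgroupI[OF N, of F "Suc (Suc k)"])
      show "?N \<subseteq> F 0" and "F (Suc (Suc k)) \<subseteq> {\<one>\<^bsub>GL\<^esub>}" unfolding F_def by auto
      show "subgroup (F (Suc i)) GL" for i
        by (simp add: F_def subgroup_two_power_torsion GL.triv_subgroup[simplified])
      show "x \<otimes>\<^bsub>GL\<^esub> y \<otimes>\<^bsub>GL\<^esub> inv\<^bsub>GL\<^esub> x \<otimes>\<^bsub>GL\<^esub> inv\<^bsub>GL\<^esub> y \<in> F (Suc i)"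
        if xy: "x \<in> F i" "x \<in> ?N" "y \<in> ?N" for i x y
      proof -
        consider "i = 0" | "0 < i" "i \<le> k" | "i = Suc k" | "Suc k < i" by linarith
        then show ?thesis
        proof cases
          case 1
          then show ?thesis
            using commutator_in_two_power_torsion[OF _ _ q k(2)] xy Nk unfolding F_def by auto
        next
          case 2
          then have "x \<in> two_power_torsion (Suc (k - i))" using xy(1) unfolding F_def by (simp add: Suc_diff_le)
          then have "x \<otimes>\<^bsub>GL\<^esub> y \<otimes>\<^bsub>GL\<^esub> inv\<^bsub>GL\<^esub> x \<otimes>\<^bsub>GL\<^esub> inv\<^bsub>GL\<^esub> y \<in> two_power_torsion (k - i)"
            using xy(3) NH by (intro commutator_descends[OF q]) auto
          then show ?thesis using 2 unfolding F_def by simp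
        next
          case 3
          then have "x \<in> two_power_torsion 0" using xy(1) unfolding F_def by simp
          then obtain c where c: "x = mat c"
            using invN[OF xy(2)] unfolding two_power_torsion_def by auto
          have "x ** y ** inv\<^bsub>GL\<^esub> x = y ** (x ** inv\<^bsub>GL\<^esub> x)"
            unfolding matrix_mul_assoc unfolding c by (simp only: mat_comm[of c y])
          then have "x ** y ** inv\<^bsub>GL\<^esub> x ** inv\<^bsub>GL\<^esub> y = mat 1"
            using GL_inv(1)[OF invN[OF xy(2)]] GL_inv(1)[OF invN[OF xy(3)]] by simp
          then show ?thesis using 3 unfolding F_def by simp
        next
          case 4
          then have "x = mat 1" using xy(1) unfolding F_def by (simp split: if_splits)
          then show ?thesis
            using 4 GL_inv(1)[OF invN[OF xy(3)]] GL_inv(1)[of "mat 1 :: 'a^'n^'n"]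
            unfolding F_def by (simp add: invertible_mat)
        qed
      qed
    qed
  qed
qed

lemma adjoin_above: "H \<subset> adjoin H"
proof -
  have "g \<in> adjoin H"
    using scalar_in[of 1] unfolding adjoin_def by (intro UnI2 image_eqI[of _ _ "mat 1"]) auto
  moreover have "g \<notin> H"
  proof
    assume "g \<in> H"
    then have "a \<in> range mat" using commutes_g_scalar[OF a] commute[OF _ a] by blast
    then show False using a_nonscalar by blast
  qed
  ultimately show ?thesis unfolding adjoin_def by blast
qed

end

section \<open>Maximality and the exceptional case\<close>

context irreducible_maximal_abelian
begin

lemma degree_2_basis:
  assumes q: "CARD('n) = 2" and X: "X \<in> H" "X \<notin> range mat" and v: "v \<noteq> 0"
  shows "vec.independent {X *v v, v}" "vec.span {X *v v, v} = UNIV"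
proof -
  have "X *v v \<notin> vec.span {v}"
  proof
    assume "X *v v \<in> vec.span {v}"
    then obtain c where "X *v v = c *s v" unfolding vec.span_singleton by blast
    then have "X = mat c" using eigenvalue_scalar[OF irr commute[OF _ X(1)]] v by blast
    then show False using X(2) by blast
  qed
  moreover have single: "vec.independent {v}" using v by simp
  ultimately show indep: "vec.independent {X *v v, v}" by (rule vec.independent_insertI)
  have "X *v v \<noteq> v" using \<open>X *v v \<notin> vec.span {v}\<close> vec.span_base[of v "{v}"] by auto
  then have "vec.dim {X *v v, v} = 2" using vec.dim_eq_card_independent[OF indep] by simp
  then have "vec.dim (UNIV :: ('a^'n) set) \<le> vec.dim (vec.span {X *v v, v})"
    using q by (simp only: vec_dim_card vec.dim_span)
  then show "vec.span {X *v v, v} = UNIV"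
    by (intro vec.subspace_dim_equal vec.subspace_span vec.subspace_UNIV subset_UNIV)
qed

text \<open>
  By completing the square: if \<open>h\<close> is nonscalar and \<open>h ** h = s + t h\<close>, then \<open>a = h - t / 2\<close> has a scalar square.
\<close>

lemma degree_2_trace_zero:
  assumes q: "CARD('n) = 2" and char: "(2::'a) \<noteq> 0"
  obtains a d where "a \<in> H" "a \<notin> range mat" "a ** a = mat d"
proof -
  obtain h where h: "h \<in> H" "h \<notin> range mat"
    using irreducible_nonscalar[OF irr prime] by blast
  obtain v :: "'a^'n" where v: "v \<noteq> 0"
    using exI[of "\<lambda>v. v \<noteq> 0" "vec 1 :: 'a^'n"] by (auto simp: vec_eq_iff)
  have "h *v (h *v v) \<in> vec.span (insert (h *v v) {v})"
    unfolding degree_2_basis(2)[OF q h v] by simp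
  then obtain t where "h *v (h *v v) - t *s (h *v v) \<in> vec.span {v}"
    unfolding vec.span_breakdown_eq by blast
  then obtain s where s: "h *v (h *v v) - t *s (h *v v) = s *s v"
    unfolding vec.span_singleton by blast
  define a where "a = h - mat (t / 2)"
  have comm: "A ** a = a ** A" if "A \<in> H" for A
    unfolding a_def matrix_diff_ldistrib matrix_diff_rdistrib commute[OF that h(1)] mat_comm[of _ A] ..
  have nonscalar: "a \<notin> range mat"
  proof
    assume "a \<in> range mat"
    then obtain c where "a = mat c" by blast
    then have "h = mat c + mat (t / 2)" unfolding a_def by (simp add: algebra_simps)
    then show False using h(2) unfolding mat_add by blast
  qed
  then have "a \<noteq> 0" using rangeI[of mat "0::'a"] by auto
  then have aH: "a \<in> H" using comm by (rule nonzero_in)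
  have av: "a *v w = h *v w - (t / 2) *s w" for w
    unfolding a_def by (simp add: matrix_vector_mult_diff_rdistrib mat_vec)
  have "a *v (a *v v) = (h *v (h *v v) - t *s (h *v v)) + (t / 2 * (t / 2)) *s v"
  proof -
    have t: "(t / 2) *s w + (t / 2) *s w = t *s w" for w :: "'a^'n"
    proof -
      have "t / 2 + t / 2 = t"
        using char by (simp add: mult_2[symmetric])
      then show ?thesis by (simp only: vec.scale_left_distrib[symmetric])
    qed
    have "a *v (a *v v) = h *v (h *v v) - ((t / 2) *s (h *v v) + (t / 2) *s (h *v v)) + (t / 2 * (t / 2)) *s v"
      unfolding av[of "a *v v"] unfolding av[of v]
      by (simp add: matrix_vector_mult_diff_distrib vec.scale vec.scale_right_diff_distrib)
    then show ?thesis unfolding t .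
  qed
  then have "(a ** a) *v v = (s + t / 2 * (t / 2)) *s v"
    unfolding s by (simp add: matrix_vector_mul_assoc vec.scale_left_distrib)
  then have "a ** a = mat (s + t / 2 * (t / 2))"
    using eigenvalue_scalar[OF irr commute[OF _ mult_closed[OF aH aH]]] v by blast
  then show ?thesis using that aH nonscalar by blast
qed

text \<open>
  The nontrivial automorphism of the quadratic extension \<open>H \<union> {0}\<close>, read as a linear map through the
  basis \<open>v\<close>, \<open>a v\<close>: the matrix \<open>g\<close> fixes \<open>v\<close> and negates \<open>a v\<close>.
\<close>

lemma degree_2_twist:
  assumes q: "CARD('n) = 2" and char: "(2::'a) \<noteq> 0"
  obtains a g where "a \<in> H" "invertible g" "g ** a = mat (- 1) ** a ** g"
proof -
  obtain a d where a: "a \<in> H" "a \<notin> range mat" and aa: "a ** a = mat d"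
    by (rule degree_2_trace_zero[OF q char])
  obtain v :: "'a^'n" where v: "v \<noteq> 0"
    using exI[of "\<lambda>v. v \<noteq> 0" "vec 1 :: 'a^'n"] by (auto simp: vec_eq_iff)
  let ?B = "{a *v v, v}"
  have span: "vec.span ?B = UNIV" by (rule degree_2_basis(2)[OF q a v])
  \<comment> \<open>a matrix is determined by its values on the basis\<close>
  have eqI: "M = M'" if "M *v v = M' *v v" "M *v (a *v v) = M' *v (a *v v)" for M M' :: "'a^'n^'n"
  proof -
    have "vec.subspace {w. M *v w = M' *v w}"
      by (auto simp: vec.subspace_def matrix_vector_right_distrib vec.scale)
    then have "vec.span ?B \<subseteq> {w. M *v w = M' *v w}"
      using that by (intro vec.span_minimal) auto
    then show ?thesis unfolding span matrix_eq by blast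
  qed
  have indep: "vec.independent ?B" by (rule degree_2_basis(1)[OF q a v])
  have "a *v v \<noteq> v"
  proof
    assume "a *v v = v"
    then have "a = mat 1" using eigenvalue_scalar[OF irr commute[OF _ a(1)], of v 1] v by simp
    then show False using a(2) by blast
  qed
  obtain f where f: "Vector_Spaces.linear (*s) (*s) f" "\<forall>x\<in>?B. f x = (if x = v then v else - x)"
    using vec.linear_independent_extend[OF indep, of "\<lambda>x. if x = v then v else - x"] by blast
  define g where "g = matrix f"
  have gf: "g *v x = f x" for x unfolding g_def by (rule matrix_works[OF f(1)])
  have gv: "g *v v = v" and gav: "g *v (a *v v) = - (a *v v)"
    using f(2) \<open>a *v v \<noteq> v\<close> unfolding gf by auto
  have minus: "mat (- 1) *v w = - w" for w :: "'a^'n" by (simp add: mat_vec)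
  have aav: "a *v (a *v v) = d *s v"
    using aa by (simp add: matrix_vector_mul_assoc mat_vec)
  have neg: "A *v (- w) = - (A *v w)" for A :: "'a^'n^'n" and w
    using vec.scale[of A "- 1" w] by simp
  have "g ** g = mat 1"
    by (rule eqI) (simp_all add: matrix_vector_mul_assoc[symmetric] gv gav neg)
  then have "invertible g" unfolding invertible_def by blast
  moreover have "g ** a = mat (- 1) ** a ** g"
    by (rule eqI) (simp_all add: matrix_vector_mul_assoc[symmetric] gv gav neg minus aav vec.scale)
  ultimately show ?thesis using that a(1) by blast
qed
end

context irreducible_maximal_abelian
begin

lemma maximal_locally_nilpotent_unless_exceptional:
  assumes "\<not> maximal_locally_nilpotent_subgroup GL H"
  shows "CARD('n) = 2" "\<nexists>i::'a. i\<^sup>2 = - 1" "\<And>b. b \<in> H \<Longrightarrow> \<exists>k. b [^]\<^bsub>GL\<^esub> ((2::nat) ^ k) \<in> range mat"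
proof -
  obtain L where L: "subgroup L GL" "locally_nilpotent (GL\<lparr>carrier := L\<rparr>)" "H \<subset> L"
    using assms unfolding maximal_locally_nilpotent_iff by blast
  obtain a g l where *: "a \<in> H" "g \<in> L" "l \<noteq> 1" "g ** a = mat l ** a ** g"
    by (rule locally_nilpotent_above_twisted[OF L])
  have g: "invertible g" using *(2) subgroup.subset[OF L(1)] by auto
  have HL: "H \<subseteq> L" using L(3) by (rule psubset_imp_subset)
  interpret locally_nilpotent_twisted H a g l L
    by (intro locally_nilpotent_twisted.intro locally_nilpotent_twisted_axioms.intro twisted_maximal_abelian.intro
        twisted_maximal_abelian_axioms.intro irreducible_maximal_abelian_axioms; fact * L(1,2) g HL)
  show q: "CARD('n) = 2" and "\<nexists>i::'a. i\<^sup>2 = - 1"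
    using degree_2_no_sqrt_minus_1 by blast+
  show "\<exists>k. b [^]\<^bsub>GL\<^esub> ((2::nat) ^ k) \<in> range mat" if "b \<in> H" for b
    using two_power_scalar[OF q that] .
qed

lemma not_maximal_locally_nilpotent:
  assumes q: "CARD('n) = 2" and char: "(2::'a) \<noteq> 0"
    and two: "\<And>b. b \<in> H \<Longrightarrow> \<exists>k. b [^]\<^bsub>GL\<^esub> ((2::nat) ^ k) \<in> range mat"
  shows "\<not> maximal_locally_nilpotent_subgroup GL H"
proof -
  obtain a g where *: "a \<in> H" "invertible g" "g ** a = mat (- 1) ** a ** g"
    by (rule degree_2_twist[OF q char])
  have "- 1 \<noteq> (1::'a)"
  proof
    assume "- 1 = (1::'a)"
    then have "1 + 1 = (0::'a)" by (metis add.right_inverse)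
    then show False using char by simp
  qed
  then interpret twisted_maximal_abelian H a g "- 1"
    by unfold_locales (use * in auto)
  have "\<exists>k. b \<in> two_power_torsion k" if "b \<in> H" for b
    using two[OF that] that unfolding two_power_torsion_def by blast
  then show ?thesis
    using adjoin_locally_nilpotent[OF q] adjoin_above unfolding maximal_locally_nilpotent_iff by blast
qed

text \<open>
  The scalar matrices lie in \<open>H\<close>, and the order of a coset divides \<open>n\<close> if and only if the \<open>n\<close>-th power is a scalar.
\<close>

lemma two_group_quotient_iff:
  "p_group 2 (GL\<lparr>carrier := H\<rparr> Mod scalar_matrices) \<longleftrightarrow>
    (\<forall>b\<in>H. \<exists>k. b [^]\<^bsub>GL\<^esub> ((2::nat) ^ k) \<in> range mat)"
proof -
  interpret HG: comm_group "GL\<lparr>carrier := H\<rparr>"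
    using maximal unfolding maximal_subgroup_with_def by blast
  have scalarH: "scalar_matrices \<subseteq> H"
    using scalar_in by (auto simp: scalar_matrices_iff)
  have "subgroup (scalar_matrices :: ('a^'n^'n) set) GL"
  proof (rule GL.subgroupI)
    show "scalar_matrices \<subseteq> carrier (GL :: ('a^'n^'n) monoid)" using scalarH invertible by auto
    have "mat 1 \<in> (scalar_matrices :: ('a^'n^'n) set)" by (auto simp: scalar_matrices_iff)
    then show "(scalar_matrices :: ('a^'n^'n) set) \<noteq> {}" by blast
    show "inv\<^bsub>GL\<^esub> X \<in> scalar_matrices" if X: "X \<in> scalar_matrices" for X :: "'a^'n^'n"
    proof -
      obtain c where c: "X = mat c" "c \<noteq> 0" using X by (auto simp: scalar_matrices_iff)
      have "inv\<^bsub>GL\<^esub> X = mat (inverse c)"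
        unfolding c(1) using GL.inv_equality[of "mat (inverse c)" "mat c"] c(2)
        by (simp add: mat_mult invertible_mat)
      then show ?thesis using c(2) by (auto simp: scalar_matrices_iff)
    qed
    show "X \<otimes>\<^bsub>GL\<^esub> Y \<in> scalar_matrices" if XY: "X \<in> scalar_matrices" "Y \<in> scalar_matrices"
      for X Y :: "'a^'n^'n"
    proof -
      obtain c d where "X = mat c" "c \<noteq> 0" "Y = mat d" "d \<noteq> 0"
        using XY by (auto simp: scalar_matrices_iff)
      then have "X ** Y = mat (c * d)" "c * d \<noteq> 0" by (simp_all add: mat_mult)
      then show ?thesis unfolding scalar_matrices_iff by auto
    qed
  qed
  then have "subgroup scalar_matrices (GL\<lparr>carrier := H\<rparr>)"
    using GL.subgroup_incl[OF _ sub scalarH] by blast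
  then have "p_group 2 (GL\<lparr>carrier := H\<rparr> Mod scalar_matrices) \<longleftrightarrow>
      (\<forall>b\<in>H. \<exists>k. b [^]\<^bsub>GL\<^esub> ((2::nat) ^ k) \<in> scalar_matrices)"
    using HG.p_group_quotient_iff[of scalar_matrices 2] GL.nat_pow_consistent[of _ _ H] by simp
  moreover have "X \<in> scalar_matrices \<longleftrightarrow> X \<in> range mat" if "X \<in> H" for X
    using invertible[OF that] by (auto simp: scalar_matrices_iff invertible_mat)
  moreover have "b [^]\<^bsub>GL\<^esub> (k::nat) \<in> H" if "b \<in> H" for b k
    using HG.nat_pow_closed[of b k] that GL.nat_pow_consistent[of b k H] by simp
  ultimately show ?thesis by simp
qed

end

theorem lemma3p19:
  fixes q :: nat and H :: "('a::field ^ 'n ^ 'n) set"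
  assumes "q = CARD('n)" and "prime q"
    and "\<exists>A :: ('a ^ 'n ^ 'n) set. subgroup A GL \<and> comm_group (GL\<lparr>carrier := A\<rparr>) \<and> irreducible_matrices A"
    and "irreducible_matrices H" and "maximal_abelian_subgroup GL H"
  shows
    "((\<nexists>x::'a. x \<in> carrier field_units \<and> group.ord field_units x = q) \<longrightarrow>
        maximal_locally_nilpotent_subgroup GL H \<and>
        (\<forall>L :: ('a ^ 'n ^ 'n) set.
           irreducible_matrices L \<and> maximal_locally_nilpotent_subgroup GL L \<longrightarrow>
           comm_group (GL\<lparr>carrier := L\<rparr>))) \<and>
     ((\<exists>x::'a. x \<in> carrier field_units \<and> group.ord field_units x = q) \<longrightarrow>
        (\<not> (q = 2 \<and> (\<nexists>i::'a. i\<^sup>2 = - 1)) \<longrightarrow> maximal_locally_nilpotent_subgroup GL H) \<and>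
        (q = 2 \<and> (\<nexists>i::'a. i\<^sup>2 = - 1) \<longrightarrow>
           (maximal_locally_nilpotent_subgroup GL H \<longleftrightarrow>
            \<not> p_group 2 (GL\<lparr>carrier := H\<rparr> Mod scalar_matrices))))"
proof -
  interpret irreducible_maximal_abelian H
    using assms by unfold_locales auto
  have q: "q = CARD('n)" by (rule assms(1))
  have root: "(\<exists>x::'a. x \<in> carrier field_units \<and> group.ord field_units x = q) \<longleftrightarrow>
      (\<exists>r::'a. r \<noteq> 1 \<and> r ^ q = 1)"
    using exists_field_units_ord_prime_iff[OF assms(2)] .
  have abelian: "comm_group (GL\<lparr>carrier := L\<rparr>)"
    if "\<nexists>r::'a. r \<noteq> 1 \<and> r ^ q = 1" "subgroup L GL" "irreducible_matrices L"
      "locally_nilpotent (GL\<lparr>carrier := L\<rparr>)" for L :: "('a^'n^'n) set"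
    using locally_nilpotent_root_of_unity[OF that(2,3) prime that(4)] that(1) unfolding q by blast
  have part1: "maximal_locally_nilpotent_subgroup GL H \<and>
      (\<forall>L :: ('a^'n^'n) set. irreducible_matrices L \<and> maximal_locally_nilpotent_subgroup GL L \<longrightarrow>
        comm_group (GL\<lparr>carrier := L\<rparr>))"
    if no_root: "\<nexists>r::'a. r \<noteq> 1 \<and> r ^ q = 1"
  proof
    show "maximal_locally_nilpotent_subgroup GL H"
      unfolding maximal_locally_nilpotent_iff
      using abelian[OF no_root] not_abelian_above irreducible_mono[OF irr] by blast
    show "\<forall>L :: ('a^'n^'n) set. irreducible_matrices L \<and> maximal_locally_nilpotent_subgroup GL L \<longrightarrow>
        comm_group (GL\<lparr>carrier := L\<rparr>)"
      using abelian[OF no_root] unfolding maximal_subgroup_with_def by blast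
  qed
  have part2: "maximal_locally_nilpotent_subgroup GL H \<longleftrightarrow>
      \<not> p_group 2 (GL\<lparr>carrier := H\<rparr> Mod scalar_matrices)"
    if two: "q = 2" and r: "r \<noteq> 1" "r ^ q = 1" for r :: 'a
  proof -
    \<comment> \<open>an element of order two excludes characteristic two\<close>
    have "(2::'a) \<noteq> 0" using of_nat_order_nonzero[OF assms(2) r] two by simp
    then show ?thesis
      using maximal_locally_nilpotent_unless_exceptional(3) not_maximal_locally_nilpotent two
      unfolding two_group_quotient_iff q by blast
  qed
  show ?thesis
    unfolding root using part1 part2 maximal_locally_nilpotent_unless_exceptional(1,2) q by blast
qed

end
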